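(* Let $n\ge 1$, let $T^n$ be the $l^1$-torus, and let $\xi:T^n\to\mathbb{R}$ be the distance function from one (fixed) point of $T^n$. Then $\xi_*m_{T^n}$ is the maximum of $\mathcal{M}(T^n;1)$ with respect to the iso-Lipschitz order $\succ'$; that is, $\xi_*m_{T^n}\in\mathcal{M}(T^n;1)$ and $\xi_*m_{T^n}\succ'\mu$ for every $\mu\in\mathcal{M}(T^n;1)$.
   Context: The $l^1$-torus $T^n$ is the $n$-fold $l^1$-product of the circle $S^1$ (the unit circle with geodesic distance $d_{S^1}$): its distance is $d((x_i),(y_i))=\sum_{i=1}^n d_{S^1}(x_i,y_i)$, and it is equipped with the uniform probability measure $m_{T^n}$, the $n$-fold product of the normalized arc-length measure on $S^1$. For a complete separable metric space $(X,d_X)$ with a Borel probability measure $m_X$, the 1-measurement is $\mathcal{M}(X;1):=\{\varphi_*m_X\mid \varphi:X\to\mathbb{R}\ \text{1-Lipschitz}\}$, where $\varphi_*m_X$ is the push-forward and 1-Lipschitz means Lipschitz constant at most $1$. For Borel probability measures $\mu,\nu$ on $\mathbb{R}$, $\mu\succ'\nu$ (iso-Lipschitz order) means that there exists a monotone non-decreasing 1-Lipschitz function $f:\operatorname{supp}\mu\to\operatorname{supp}\nu$ with $f_*\mu=\nu$. *)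

theory Defs
  imports "HOL-Probability.Probability"
begin

abbreviation circle :: "complex set" where
  "circle \<equiv> sphere 0 1"

text \<open>
  An arc from \<open>x\<close> to \<open>y\<close> that sweeps the signed angle \<open>t\<close> has length \<open>\<bar>t\<bar>\<close>, and it
  ends at \<open>y\<close> iff \<open>y = x * cis t\<close>. The geodesic distance is the least such length.
\<close>

definition circle_dist :: "complex \<Rightarrow> complex \<Rightarrow> real" where
  "circle_dist x y = Inf {\<bar>t\<bar> | t. y = x * cis t}"

text \<open>
  Normalized arc length: the image of the uniform distribution on \<open>[0, 2\<pi>)\<close> under the
  arc-length parametrization of the circle.
\<close>

definition circle_measure :: "complex measure" where
  "circle_measure =
     distr (uniform_measure lborel {0..<2 * pi}) (restrict_space borel circle) cis"

definition torus :: "nat \<Rightarrow> (nat \<Rightarrow> complex) set" where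
  "torus n = (\<Pi>\<^sub>E i\<in>{..<n}. circle)"

definition torus_dist :: "nat \<Rightarrow> (nat \<Rightarrow> complex) \<Rightarrow> (nat \<Rightarrow> complex) \<Rightarrow> real" where
  "torus_dist n x y = (\<Sum>i<n. circle_dist (x i) (y i))"

definition torus_measure :: "nat \<Rightarrow> (nat \<Rightarrow> complex) measure" where
  "torus_measure n = (\<Pi>\<^sub>M i\<in>{..<n}. circle_measure)"

definition one_Lipschitz_on :: "'a set \<Rightarrow> ('a \<Rightarrow> 'a \<Rightarrow> real) \<Rightarrow> ('a \<Rightarrow> real) \<Rightarrow> bool" where
  "one_Lipschitz_on X d \<phi> \<longleftrightarrow> (\<forall>x\<in>X. \<forall>y\<in>X. \<bar>\<phi> x - \<phi> y\<bar> \<le> d x y)"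

text \<open>
  The 1-measurement of the metric measure space \<open>(X, d, m)\<close>, where \<open>m\<close> is a Borel
  probability measure with \<open>space m = X\<close>; 1-Lipschitz functions are then measurable
  (proved below for the torus, where \<open>m\<close> is a product measure), so every push-forward is
  a probability measure.
\<close>

definition measurement1 :: "'a set \<Rightarrow> ('a \<Rightarrow> 'a \<Rightarrow> real) \<Rightarrow> 'a measure \<Rightarrow> real measure set" where
  "measurement1 X d m = {distr m borel \<phi> | \<phi>. one_Lipschitz_on X d \<phi>}"

definition msupport :: "'a::topological_space measure \<Rightarrow> 'a set" where
  "msupport \<mu> = {x. \<forall>U. open U \<and> x \<in> U \<longrightarrow> emeasure \<mu> U > 0}"

text \<open>
  The map \<open>f\<close> only lives on the support of \<open>\<mu>\<close> (which has full measure), so the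
  push-forward is taken of the restriction of \<open>\<mu>\<close> to its support.
\<close>

definition iso_Lipschitz_ge :: "real measure \<Rightarrow> real measure \<Rightarrow> bool"
    (infix \<open>\<succ>''\<close> 50) where
  "\<mu> \<succ>' \<nu> \<longleftrightarrow>
     (\<exists>f. f \<in> msupport \<mu> \<rightarrow> msupport \<nu> \<and> mono_on (msupport \<mu>) f \<and>
          1-lipschitz_on (msupport \<mu>) f \<and>
          distr (restrict_space \<mu> (msupport \<mu>)) borel f = \<nu>)"


subsection \<open>The torus as a metric measure space\<close>

lemma circle_dist_le: "y = x * cis t \<Longrightarrow> circle_dist x y \<le> \<bar>t\<bar>"
  unfolding circle_dist_def by (rule cInf_lower) (auto intro!: bdd_belowI[of _ 0])

lemma circle_dist_eq_Arg:
  assumes "x \<in> circle" "y \<in> circle"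
  shows "y = x * cis (Arg (y / x))" and "circle_dist x y = \<bar>Arg (y / x)\<bar>"
proof -
  have nz: "x \<noteq> 0" "y \<noteq> 0" and n: "norm (y / x) = 1"
    using assms by (auto simp: norm_divide)
  show y: "y = x * cis (Arg (y / x))"
    using nz n by (simp add: cis_Arg sgn_div_norm)
  have "\<bar>Arg (y / x)\<bar> \<le> \<bar>t\<bar>" if "y = x * cis t" for t
  proof (cases "\<bar>t\<bar> < pi")
    case True
    have "Arg (y / x) = t"
      using that nz True by (intro cis_Arg_unique) (auto simp: sgn_div_norm)
    then show ?thesis by simp
  next
    case False
    then show ?thesis using Arg_bounded[of "y / x"] by linarith
  qed
  then show "circle_dist x y = \<bar>Arg (y / x)\<bar>"
    unfolding circle_dist_def using y by (intro cInf_eq_minimum) blast+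
qed

lemma circle_dist_nonneg: "x \<in> circle \<Longrightarrow> y \<in> circle \<Longrightarrow> 0 \<le> circle_dist x y"
  by (simp add: circle_dist_eq_Arg)

lemma circle_dist_zero_iff:
  "x \<in> circle \<Longrightarrow> y \<in> circle \<Longrightarrow> circle_dist x y = 0 \<longleftrightarrow> x = y"
  using circle_dist_eq_Arg[of x y] circle_dist_le[of y x 0] circle_dist_nonneg[of x y] by auto

lemma circle_dist_commute:
  "x \<in> circle \<Longrightarrow> y \<in> circle \<Longrightarrow> circle_dist x y = circle_dist y x"
proof -
  have le: "circle_dist y x \<le> circle_dist x y" if "x \<in> circle" "y \<in> circle" for x y
  proof -
    have "y = x * cis (Arg (y / x))"
      using that by (rule circle_dist_eq_Arg)
    then have "y * cis (- Arg (y / x)) = x * (cis (Arg (y / x)) * cis (- Arg (y / x)))"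
      by (metis mult.assoc)
    then have "x = y * cis (- Arg (y / x))"
      by (simp only: cis_mult) simp
    then show ?thesis
      using circle_dist_le circle_dist_eq_Arg(2)[OF that] by fastforce
  qed
  show "x \<in> circle \<Longrightarrow> y \<in> circle \<Longrightarrow> circle_dist x y = circle_dist y x"
    using le[of x y] le[of y x] by simp
qed

lemma circle_dist_triangle:
  assumes "x \<in> circle" "y \<in> circle" "z \<in> circle"
  shows "circle_dist x z \<le> circle_dist x y + circle_dist y z"
proof -
  have "z = x * cis (Arg (y / x)) * cis (Arg (z / y))"
    using circle_dist_eq_Arg(1)[of x y] circle_dist_eq_Arg(1)[of y z] assms by metis
  then have "z = x * cis (Arg (y / x) + Arg (z / y))"
    by (simp add: cis_mult mult.assoc)
  then have "circle_dist x z \<le> \<bar>Arg (y / x) + Arg (z / y)\<bar>"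
    by (rule circle_dist_le)
  then show ?thesis
    using assms by (simp add: circle_dist_eq_Arg(2))
qed

lemma torusD: "x \<in> torus n \<Longrightarrow> i < n \<Longrightarrow> x i \<in> circle"
  unfolding torus_def by (drule PiE_mem[where x = i]) simp_all

lemma torus_dist_nonneg: "x \<in> torus n \<Longrightarrow> y \<in> torus n \<Longrightarrow> 0 \<le> torus_dist n x y"
  unfolding torus_dist_def by (intro sum_nonneg circle_dist_nonneg torusD) auto

lemma torus_dist_zero_iff:
  assumes "x \<in> torus n" "y \<in> torus n"
  shows "torus_dist n x y = 0 \<longleftrightarrow> x = y"
proof -
  have "torus_dist n x y = 0 \<longleftrightarrow> (\<forall>i\<in>{..<n}. circle_dist (x i) (y i) = 0)"
    unfolding torus_dist_def
    by (intro sum_nonneg_eq_0_iff) (auto intro!: circle_dist_nonneg dest: torusD assms[THEN torusD])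
  also have "\<dots> \<longleftrightarrow> (\<forall>i\<in>{..<n}. x i = y i)"
    using assms[THEN torusD] by (intro ball_cong refl circle_dist_zero_iff) auto
  also have "\<dots> \<longleftrightarrow> x = y"
    using assms unfolding torus_def by (auto intro: PiE_ext)
  finally show ?thesis .
qed

lemma torus_dist_commute:
  "x \<in> torus n \<Longrightarrow> y \<in> torus n \<Longrightarrow> torus_dist n x y = torus_dist n y x"
  unfolding torus_dist_def by (intro sum.cong refl circle_dist_commute torusD) auto

lemma torus_dist_triangle:
  "x \<in> torus n \<Longrightarrow> y \<in> torus n \<Longrightarrow> z \<in> torus n \<Longrightarrow>
    torus_dist n x z \<le> torus_dist n x y + torus_dist n y z"
  unfolding torus_dist_def sum.distrib[symmetric]
  by (intro sum_mono circle_dist_triangle torusD) auto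

lemma cis_measurable:
  "cis \<in> uniform_measure lborel {0..<2 * pi} \<rightarrow>\<^sub>M restrict_space borel circle"
proof -
  have "cis \<in> borel_measurable borel"
    by (intro borel_measurable_continuous_onI continuous_intros)
  then show ?thesis
    by (intro measurable_restrict_space2) auto
qed

lemma prob_space_circle_measure: "prob_space circle_measure"
  unfolding circle_measure_def
  by (intro prob_space.prob_space_distr prob_space_uniform_measure cis_measurable) auto

lemma space_circle_measure [simp]: "space circle_measure = circle"
  by (simp add: circle_measure_def space_restrict_space)

lemma sets_circle_measure: "sets circle_measure = sets (restrict_space borel circle)"
  by (simp add: circle_measure_def)

lemma prob_space_torus_measure: "prob_space (torus_measure n)"
  unfolding torus_measure_def by (intro prob_space_PiM prob_space_circle_measure)

lemma space_torus_measure [simp]: "space (torus_measure n) = torus n"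
  by (simp add: torus_measure_def torus_def space_PiM)

lemma one_Lipschitz_on_torus_measurable:
  assumes "one_Lipschitz_on (torus n) (torus_dist n) \<phi>"
  shows "\<phi> \<in> borel_measurable (torus_measure n)"
proof -
  have "(\<phi> \<longlongrightarrow> \<phi> x) (at x within torus n)" if x: "x \<in> torus n" for x
  proof -
    have "((\<lambda>y. \<Sum>i<n. \<bar>Arg (y i / x i)\<bar>) \<longlongrightarrow> (\<Sum>i<n. \<bar>Arg 1\<bar>)) (at x within torus n)"
    proof (intro tendsto_sum tendsto_rabs)
      fix i assume "i \<in> {..<n}"
      then have nz: "x i \<noteq> 0" using torusD[OF x, of i] by auto
      have "((\<lambda>y. y i) \<longlongrightarrow> x i) (at x within torus n)"
        using continuous_on_subset[OF continuous_on_product_coordinates[of i] subset_UNIV] x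
        unfolding continuous_on_def by blast
      then have "((\<lambda>y. y i / x i) \<longlongrightarrow> x i / x i) (at x within torus n)"
        using nz by (intro tendsto_divide tendsto_const)
      then have "((\<lambda>y. y i / x i) \<longlongrightarrow> 1) (at x within torus n)"
        using nz by simp
      then show "((\<lambda>y. Arg (y i / x i)) \<longlongrightarrow> Arg 1) (at x within torus n)"
        by (rule isCont_tendsto_compose[rotated]) (rule continuous_at_Arg, simp)
    qed
    then have lim: "((\<lambda>y. \<Sum>i<n. \<bar>Arg (y i / x i)\<bar>) \<longlongrightarrow> 0) (at x within torus n)"
      by simp
    have "\<forall>\<^sub>F y in at x within torus n. norm (\<phi> y - \<phi> x) \<le> (\<Sum>i<n. \<bar>Arg (y i / x i)\<bar>)"
      unfolding eventually_at_topological
    proof (intro exI[of _ UNIV] conjI ballI impI)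
      fix y assume y: "y \<in> torus n"
      have "norm (\<phi> y - \<phi> x) \<le> torus_dist n x y"
        using assms x y unfolding one_Lipschitz_on_def by (simp add: abs_minus_commute)
      also have "\<dots> = (\<Sum>i<n. \<bar>Arg (y i / x i)\<bar>)"
        unfolding torus_dist_def
        using torusD[OF x] torusD[OF y] by (intro sum.cong refl circle_dist_eq_Arg(2)) auto
      finally show "norm (\<phi> y - \<phi> x) \<le> (\<Sum>i<n. \<bar>Arg (y i / x i)\<bar>)" .
    qed auto
    then have "((\<lambda>y. \<phi> y - \<phi> x) \<longlongrightarrow> 0) (at x within torus n)"
      using lim by (rule Lim_null_comparison)
    then show ?thesis
      by (rule LIM_zero_cancel)
  qed
  then have "continuous_on (torus n) \<phi>"
    by (simp add: continuous_on_def)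
  then have \<phi>: "\<phi> \<in> restrict_space borel (torus n) \<rightarrow>\<^sub>M borel"
    by (rule borel_measurable_continuous_on_restrict)
  have "(\<lambda>x. x) \<in> torus_measure n \<rightarrow>\<^sub>M borel"
  proof (rule measurable_coordinatewise_then_product)
    fix i
    show "(\<lambda>x. x i) \<in> torus_measure n \<rightarrow>\<^sub>M borel"
    proof (cases "i < n")
      case True
      then have "(\<lambda>x. x i) \<in> torus_measure n \<rightarrow>\<^sub>M circle_measure"
        unfolding torus_measure_def by (intro measurable_component_singleton) simp
      then have "(\<lambda>x. x i) \<in> torus_measure n \<rightarrow>\<^sub>M restrict_space borel circle"
        by (simp add: measurable_cong_sets[OF refl sets_circle_measure])
      then show ?thesis
        by (simp add: measurable_restrict_space2_iff)
    next
      case False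
      have undef: "x i = undefined" if "x \<in> space (torus_measure n)" for x
      proof -
        have "x \<in> (\<Pi>\<^sub>E i\<in>{..<n}. circle)" using that by (simp add: torus_def)
        moreover have "i \<notin> {..<n}" using False by simp
        ultimately show ?thesis by (rule PiE_arb)
      qed
      show ?thesis
        using measurable_cong[where M = "torus_measure n" and M' = borel, OF undef] by simp
    qed
  qed
  then have "(\<lambda>x. x) \<in> torus_measure n \<rightarrow>\<^sub>M restrict_space borel (torus n)"
    by (intro measurable_restrict_space2) auto
  from measurable_compose[OF this \<phi>] show ?thesis .
qed

end

theory Submission
  imports Defs
begin

text \<open>
  The statement is an isoperimetric inequality in disguise. Let \<open>F\<close> be the distribution function of
  \<open>\<xi>\<close>. The natural monotone map that carries the distribution of \<open>\<xi>\<close> to that of a 1-Lipschitz function \<open>\<phi>\<close>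
  matches quantiles: it sends \<open>r\<close> to the least \<open>a\<close> such that \<open>{\<phi> \<le> a}\<close> has measure at least \<open>F r\<close>. This
  map is 1-Lipschitz as soon as \<open>{\<phi> \<le> a + s}\<close> has measure at least \<open>F (r + s)\<close> whenever \<open>{\<phi> \<le> a}\<close> has
  measure at least \<open>F r\<close>. As \<open>{\<phi> \<le> a + s}\<close> contains the \<open>s\<close>-neighbourhood of \<open>{\<phi> \<le> a}\<close>, it is enough that
  balls have the smallest neighbourhoods among all sets of the same measure. This is the
  predicate \<open>isoperimetric\<close>; the reduction is \<open>dominates_pushforward\<close>.

  The isoperimetric inequality is proved by induction on the dimension. On the circle it holds because
  a set that misses a neighbourhood of some point grows at least by \<open>s\<close> at both ends
  (\<open>isoperimetric_circle\<close>). For a product of a lower-dimensional torus with a circle, every fibre over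
  the circle is replaced by a ball of the same measure, and the radii of these balls are rearranged into
  a decreasing function on an interval (\<open>isoperimetric_pair\<close>). The induction hypothesis and the
  inequality on the circle say that the measure of a neighbourhood does not grow in the process.

  This leaves a problem in the plane: regions \<open>t \<le> c u\<close> in the strip \<open>0 < u < 1\<close> with decreasing \<open>c\<close>, the
  measure \<open>dF \<otimes> du\<close>, and the \<open>l\<^sup>1\<close>-distance; the balls are the regions \<open>t \<le> r - u\<close>. If \<open>c u + u\<close>
  increases, then the region crosses the boundary of a ball only once, and log-concavity of the distribution
  \<open>F\<close> of a sum of independent uniform variables gives the claim
  (\<open>increasing_profile_expansion\<close>). In general, \<open>c u + u\<close> can be made increasing by filling its
  valleys below some level and shaving off its peaks above it. This does not raise the growth of the
  region, and for a suitable level it does not change its measure (\<open>strip_isoperimetry\<close>).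
\<close>

section \<open>Log-concave distribution functions\<close>

abbreviation unit_interval :: "real measure" where
  "unit_interval \<equiv> restrict_space lborel {0<..<1}"

interpretation unit_interval: prob_space unit_interval
  by (auto simp: emeasure_restrict_space space_restrict_space intro!: prob_spaceI)

lemma space_unit_interval [simp]: "space unit_interval = {0<..<1}"
  by (simp add: space_restrict_space)

lemma measurable_unit_interval_mono_on:
  fixes f :: "real \<Rightarrow> real"
  assumes "mono_on {0<..<1} f"
  shows "f \<in> borel_measurable unit_interval"
proof -
  have "sets unit_interval = sets (restrict_space borel {0<..<1})"
    by (simp cong: sets_restrict_space_cong)
  then show ?thesis
    using borel_measurable_mono_on_fnc[OF assms] by (simp cong: measurable_cong_sets)
qed

lemma integrable_unit_interval_mono_on:
  fixes f :: "real \<Rightarrow> real"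
  assumes "mono_on {0<..<1} f" "\<And>u. \<bar>f u\<bar> \<le> B"
  shows "integrable unit_interval f"
  by (intro unit_interval.integrable_const_bound[of _ B] measurable_unit_interval_mono_on)
     (auto simp: assms)

lemma integrable_unit_interval_antimono_on:
  fixes f :: "real \<Rightarrow> real"
  assumes "\<And>u v. 0 < u \<Longrightarrow> u \<le> v \<Longrightarrow> v < 1 \<Longrightarrow> f v \<le> f u" "\<And>u. \<bar>f u\<bar> \<le> B"
  shows "integrable unit_interval f"
proof -
  have "integrable unit_interval (\<lambda>u. - f u)"
    by (rule integrable_unit_interval_mono_on[of _ B]) (auto intro!: mono_onI simp: assms)
  then show ?thesis by simp
qed

text \<open>
  Wherever \<open>\<phi>\<close> is positive at \<open>u\<close>, it is paid for by \<open>\<psi>\<close> at the translate \<open>u + \<delta>\<close>. Translation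
  preserves Lebesgue measure, and distinct points have distinct translates.
\<close>

lemma integral_unit_interval_shift_le:
  fixes \<phi> \<psi> :: "real \<Rightarrow> real"
  assumes "integrable unit_interval \<phi>" "integrable unit_interval \<psi>"
    and "\<And>u. 0 < u \<Longrightarrow> u < 1 \<Longrightarrow> 0 \<le> \<psi> u"
    and "\<And>u. 0 < u \<Longrightarrow> u < 1 \<Longrightarrow>
           \<phi> u \<le> 0 \<or> (0 < u + \<delta> \<and> u + \<delta> < 1 \<and> \<phi> u \<le> \<psi> (u + \<delta>))"
  shows "integral\<^sup>L unit_interval \<phi> \<le> integral\<^sup>L unit_interval \<psi>"
proof -
  let ?\<psi> = "\<lambda>u. indicat_real {0<..<1} u * \<psi> u"
  have i1: "integrable lborel (\<lambda>u. indicat_real {0<..<1} u * \<phi> u)"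
    and i2: "integrable lborel ?\<psi>"
    using assms(1,2) by (simp_all add: integrable_restrict_space)
  have i3: "integrable lborel (\<lambda>u. ?\<psi> (\<delta> + 1 * u))"
    by (rule lborel_integrable_real_affine[OF i2]) simp
  have "integral\<^sup>L unit_interval \<phi> = (\<integral>u. indicat_real {0<..<1} u * \<phi> u \<partial>lborel)"
    by (simp add: integral_restrict_space)
  also have "\<dots> \<le> (\<integral>u. ?\<psi> (\<delta> + 1 * u) \<partial>lborel)"
  proof (rule integral_mono[OF i1 i3])
    fix u :: real
    show "indicat_real {0<..<1} u * \<phi> u \<le> ?\<psi> (\<delta> + 1 * u)"
      using assms(3)[of "\<delta> + u"] assms(4)[of u]
      by (cases "0 < u \<and> u < 1"; cases "0 < \<delta> + u \<and> \<delta> + u < 1") (auto simp: indicator_def add.commute)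
  qed
  also have "\<dots> = (\<integral>u. ?\<psi> u \<partial>lborel)"
    using lborel_integral_real_affine[of 1 ?\<psi> \<delta>] by simp
  also have "\<dots> = integral\<^sup>L unit_interval \<psi>"
    by (simp add: integral_restrict_space)
  finally show ?thesis .
qed

text \<open>
  If \<open>F\<close> has a density \<open>f\<close>, the inequality is the integrated form of
  \<open>f (y + s) * f x \<le> f (x + s) * f y\<close> for \<open>x \<le> y\<close>, that is, of log-concavity of \<open>f\<close>: pushing two
  intervals to the right by \<open>s\<close> shrinks the mass of the right one by at least as large a factor.
  Stating it for increments avoids densities and divisions by zero.
\<close>

definition increments_log_concave :: "(real \<Rightarrow> real) \<Rightarrow> bool" where
  "increments_log_concave F \<longleftrightarrow>
     (\<forall>a b c d s. a \<le> b \<longrightarrow> b \<le> c \<longrightarrow> c \<le> d \<longrightarrow> 0 \<le> s \<longrightarrow>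
        (F (d + s) - F (c + s)) * (F b - F a) \<le> (F (b + s) - F (a + s)) * (F d - F c))"

lemma increments_log_concaveD:
  "increments_log_concave F \<Longrightarrow> a \<le> b \<Longrightarrow> b \<le> c \<Longrightarrow> c \<le> d \<Longrightarrow> 0 \<le> s \<Longrightarrow>
    (F (d + s) - F (c + s)) * (F b - F a) \<le> (F (b + s) - F (a + s)) * (F d - F c)"
  unfolding increments_log_concave_def by blast

text \<open>
  The Lipschitz condition stands for a density bounded by one, which all sums of variables uniform
  on \<open>[0, 1]\<close> have; it is used for passages to the limit.
\<close>

locale log_concave_cdf =
  fixes F :: "real \<Rightarrow> real" and L :: real
  assumes mono: "a \<le> b \<Longrightarrow> F a \<le> F b"
    and lipschitz: "\<bar>F a - F b\<bar> \<le> \<bar>a - b\<bar>"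
    and below: "t \<le> 0 \<Longrightarrow> F t = 0"
    and above: "L \<le> t \<Longrightarrow> F t = 1"
    and increments: "increments_log_concave F"
begin

lemma nonneg: "0 \<le> F t" and le_one: "F t \<le> 1"
  using mono[of "min t 0" t] below[of "min t 0"] mono[of t "max t L"] above[of "max t L"] by auto

lemma abs_le_one: "\<bar>F t\<bar> \<le> 1"
  using nonneg[of t] le_one[of t] by simp

lemma isCont: "isCont F x"
proof -
  have "((\<lambda>t. F t - F x) \<longlongrightarrow> 0) (at x)"
    by (rule Lim_null_comparison[of _ "\<lambda>t. \<bar>t - x\<bar>"])
       (auto intro!: always_eventually lipschitz tendsto_rabs_zero LIM_zero)
  then show ?thesis unfolding isCont_def by (rule LIM_zero_cancel)
qed

lemma continuous: "continuous_on A F"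
  by (simp add: continuous_at_imp_continuous_on isCont)

lemma borel_measurable_cdf [measurable]: "F \<in> borel_measurable borel"
  by (rule borel_measurable_continuous_onI[OF continuous])

lemma integrable_shift: "integrable unit_interval (\<lambda>u. F (t - u))"
  by (rule integrable_unit_interval_antimono_on[of _ 1]) (auto intro: mono abs_le_one)

lemma le_of_left_limit:
  assumes "\<And>\<epsilon>. 0 < \<epsilon> \<Longrightarrow> F (t - \<epsilon>) \<le> y"
  shows "F t \<le> y"
proof (rule field_le_epsilon)
  fix e :: real assume "0 < e"
  then show "F t \<le> y + e" using assms[of e] lipschitz[of t "t - e"] by simp
qed

end

text \<open>
  The average over \<open>u\<close> smooths \<open>F\<close> over a window of length one; this form exhibits the derivative
  \<open>F t - F (t - 1)\<close> of the average.
\<close>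

lemma integral_unit_interval_reflect:
  fixes F :: "real \<Rightarrow> real"
  assumes "continuous_on UNIV F"
  shows "(\<integral>u. F (t - u) \<partial>unit_interval) = integral {t - 1..t} F"
proof -
  have "(\<integral>u. F (t - u) \<partial>unit_interval) = (\<integral>u. indicat_real {0<..<1} u * F (t - u) \<partial>lborel)"
    by (simp add: integral_restrict_space)
  also have "\<dots> = (\<integral>u. indicat_real {t - 1<..<t} (t + (-1) * u) * F (t + (-1) * u) \<partial>lborel)"
    by (intro Bochner_Integration.integral_cong) (auto simp: indicator_def)
  also have "\<dots> = (\<integral>u. indicat_real {t - 1<..<t} u * F u \<partial>lborel)"
    using lborel_integral_real_affine[of "-1" "\<lambda>u. indicat_real {t - 1<..<t} u * F u" t] by simp
  also have "\<dots> = (LINT u:{t - 1..t}|lborel. F u)"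
    unfolding set_lebesgue_integral_def
  proof (rule integral_cong_AE)
    show "AE u in lborel. indicat_real {t - 1<..<t} u * F u = indicat_real {t - 1..t} u *\<^sub>R F u"
      using AE_lborel_singleton[of t] AE_lborel_singleton[of "t - 1"]
      by eventually_elim (auto simp: indicator_def)
  qed (use borel_measurable_continuous_onI[OF assms] in measurable)
  also have "\<dots> = integral {t - 1..t} F"
    by (intro set_borel_integral_eq_integral(2) borel_integrable_atLeastAtMost')
       (rule continuous_on_subset[OF assms], simp)
  finally show ?thesis .
qed

definition uniform_cdf :: "real \<Rightarrow> real" where
  "uniform_cdf t = max 0 (min 1 t)"

lemma log_concave_cdf_uniform: "log_concave_cdf uniform_cdf 1"
proof
  show "increments_log_concave uniform_cdf"
    unfolding increments_log_concave_def
  proof (intro allI impI)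
    fix a b c d s :: real
    assume *: "a \<le> b" "b \<le> c" "c \<le> d" "0 \<le> s"
    let ?U = uniform_cdf
    have nn: "0 \<le> ?U (d + s) - ?U (c + s)" "0 \<le> ?U b - ?U a" "0 \<le> ?U (b + s) - ?U (a + s)"
      "0 \<le> ?U d - ?U c"
      using * by (auto simp: uniform_cdf_def)
    show "(?U (d + s) - ?U (c + s)) * (?U b - ?U a) \<le> (?U (b + s) - ?U (a + s)) * (?U d - ?U c)"
    proof (cases "c + s < 1 \<and> 0 < b")
      \<comment> \<open>Before the shift, \<open>[c, d]\<close> lies to the right of 0, so it can only lose mass; after the shift, \<open>[a, b]\<close> lies to the left of 1, so it can only have gained.\<close>
      case True
      then have "?U (d + s) - ?U (c + s) \<le> ?U d - ?U c" "?U b - ?U a \<le> ?U (b + s) - ?U (a + s)"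
        using * by (auto simp: uniform_cdf_def max_def min_def)
      then show ?thesis
        using nn by (subst mult.commute) (intro mult_mono, auto)
    next
      case False
      then have "?U (d + s) - ?U (c + s) = 0 \<or> ?U b - ?U a = 0"
        using * by (auto simp: uniform_cdf_def max_def min_def)
      then show ?thesis using nn by auto
    qed
  qed
qed (auto simp: uniform_cdf_def)

text \<open>
  Recovers the inequality for increments from that for densities by integrating over \<open>x \<in> [a, b]\<close> and
  \<open>y \<in> [c, d]\<close>.
\<close>

lemma increments_log_concave_integral:
  fixes F f :: "real \<Rightarrow> real"
  assumes cont: "continuous_on UNIV f"
    and F: "\<And>a b. a \<le> b \<Longrightarrow> F b - F a = integral {a..b} f"
    and f: "\<And>x y s. x \<le> y \<Longrightarrow> 0 \<le> s \<Longrightarrow> f x * f (y + s) \<le> f (x + s) * f y"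
  shows "increments_log_concave F"
  unfolding increments_log_concave_def
proof (intro allI impI)
  fix a b c d s :: real
  assume *: "a \<le> b" "b \<le> c" "c \<le> d" "0 \<le> s"
  have c': "continuous_on A f" "continuous_on A (\<lambda>x. f (x + s))" for A
    by (auto intro!: continuous_intros continuous_on_compose2[OF cont] continuous_on_subset[OF cont])
  have int [simp]: "f integrable_on {u..v}" "(\<lambda>x. f (x + s)) integrable_on {u..v}" for u v
    by (auto intro!: integrable_continuous_real c')
  have sh: "F (v + s) - F (u + s) = integral {u..v} (\<lambda>x. f (x + s))" if "u \<le> v" for u v
  proof -
    have "integral {u..v} (f \<circ> (\<lambda>x. x + s)) = integral {u + s..v + s} f"
      by (rule integral_shift) (rule c')
    then show ?thesis using that by (simp add: F o_def)
  qed
  have inner: "f x * integral {c..d} (\<lambda>y. f (y + s)) \<le> f (x + s) * integral {c..d} f" if "x \<le> b" for x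
  proof -
    have "integral {c..d} (\<lambda>y. f x * f (y + s)) \<le> integral {c..d} (\<lambda>y. f (x + s) * f y)"
      using that * by (intro integral_le integrable_on_mult_right int f) auto
    then show ?thesis by simp
  qed
  have "integral {a..b} (\<lambda>x. f x * integral {c..d} (\<lambda>y. f (y + s)))
      \<le> integral {a..b} (\<lambda>x. f (x + s) * integral {c..d} f)"
    using inner by (intro integral_le integrable_on_mult_left int) auto
  then show "(F (d + s) - F (c + s)) * (F b - F a) \<le> (F (b + s) - F (a + s)) * (F d - F c)"
    using * by (simp add: sh[OF *(1)] sh[OF *(3)] F[OF *(1)] F[OF *(3)] mult.commute)
qed

text \<open>
  Adding an independent uniform variable preserves log-concavity (an elementary instance of
  Prekopa's theorem). The new density is \<open>f t = F t - F (t - 1)\<close>, the mass of a unit window. If the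
  windows ending at \<open>x \<le> y\<close> overlap, they share the interval \<open>[y - 1, x]\<close>, whose contributions to
  both sides of the required inequality coincide; the remaining parts are ordered, and log-concavity
  of \<open>F\<close> applies to each pair of them.
\<close>

lemma log_concave_cdf_convolution:
  assumes "log_concave_cdf F L"
  shows "log_concave_cdf (\<lambda>t. \<integral>u. F (t - u) \<partial>unit_interval) (L + 1)"
proof -
  interpret log_concave_cdf F L by fact
  let ?G = "\<lambda>t. \<integral>u. F (t - u) \<partial>unit_interval"
  have cont: "continuous_on UNIV F" by (rule continuous)
  have G: "?G t = integral {t - 1..t} F" for t
    by (rule integral_unit_interval_reflect[OF cont])
  define f where "f t = F t - F (t - 1)" for t
  have int: "F integrable_on {u..v}" for u v
    by (intro integrable_continuous_real continuous)
  have "increments_log_concave ?G"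
  proof (rule increments_log_concave_integral)
    show "continuous_on UNIV f"
      unfolding f_def by (intro continuous_intros continuous_on_compose2[OF cont]) auto
    fix a b :: real assume ab: "a \<le> b"
    have prim: "integral {u..v} F = integral {min 0 (a - 1)..v} F - integral {min 0 (a - 1)..u} F"
      if "min 0 (a - 1) \<le> u" "u \<le> v" for u v
      using Henstock_Kurzweil_Integration.integral_combine[OF that int] by simp
    have "integral {a..b} (\<lambda>x. F (x - 1)) = integral {a - 1..b - 1} F"
    proof -
      have "integral {a..b} (F \<circ> (\<lambda>x. x + (-1))) = integral {a + (-1)..b + (-1)} F"
        by (rule integral_shift) (rule continuous)
      then show ?thesis by (simp add: o_def)
    qed
    moreover have "(\<lambda>x. F (x - 1)) integrable_on {a..b}"
      by (intro integrable_continuous_real continuous_intros continuous_on_compose2[OF cont]) auto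
    ultimately have "integral {a..b} f = integral {a..b} F - integral {a - 1..b - 1} F"
      unfolding f_def using int by (simp add: Henstock_Kurzweil_Integration.integral_diff)
    then show "?G b - ?G a = integral {a..b} f"
      using ab prim[of "b - 1" b] prim[of "a - 1" a] prim[of a b] prim[of "a - 1" "b - 1"]
      by (simp add: G)
  next
    fix x y s :: real assume xy: "x \<le> y" and s: "0 \<le> s"
    note I = increments_log_concaveD[OF increments _ _ _ s]
    show "f x * f (y + s) \<le> f (x + s) * f y"
    proof (cases "y - 1 \<le> x")
      case True
      have "f x * f (y + s)
          = ((F (y - 1) - F (x - 1)) + (F x - F (y - 1)))
          * ((F (x + s) - F (y - 1 + s)) + (F (y + s) - F (x + s)))"
        by (simp add: f_def algebra_simps)
      moreover have "f (x + s) * f y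
          = ((F (y - 1 + s) - F (x - 1 + s)) + (F (x + s) - F (y - 1 + s)))
          * ((F x - F (y - 1)) + (F y - F x))"
        by (simp add: f_def algebra_simps)
      ultimately show ?thesis
        using I[of "x - 1" "y - 1" "y - 1" x] I[of "x - 1" "y - 1" x y] I[of "y - 1" x x y] xy True
        by (simp add: algebra_simps)
    next
      case False
      then show ?thesis
        using I[of "x - 1" x "y - 1" y] by (simp add: f_def algebra_simps)
    qed
  qed
  then show ?thesis
  proof unfold_locales
    show "?G a \<le> ?G b" if "a \<le> b" for a b
      using that by (intro integral_mono integrable_shift mono) auto
    show "\<bar>?G a - ?G b\<bar> \<le> \<bar>a - b\<bar>" for a b
    proof -
      have "?G a - ?G b = (\<integral>u. F (a - u) - F (b - u) \<partial>unit_interval)"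
        by (simp add: integrable_shift)
      also have "\<bar>\<dots>\<bar> \<le> (\<integral>u. \<bar>F (a - u) - F (b - u)\<bar> \<partial>unit_interval)"
        by (rule integral_abs_bound)
      also have "\<dots> \<le> (\<integral>u. \<bar>a - b\<bar> \<partial>unit_interval)"
        using lipschitz[of "a - u" "b - u" for u]
        by (intro integral_mono integrable_abs Bochner_Integration.integrable_diff integrable_shift) auto
      also have "\<dots> = \<bar>a - b\<bar>"
        using unit_interval.prob_space by simp
      finally show ?thesis .
    qed
    show "?G t = 0" if "t \<le> 0" for t
      using that by (intro integral_eq_zero_AE AE_I2) (auto intro: below)
    show "?G t = 1" if "L + 1 \<le> t" for t
    proof -
      have "?G t = (\<integral>u. 1 \<partial>unit_interval)"
        using that by (intro Bochner_Integration.integral_cong) (auto intro: above)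
      then show ?thesis using unit_interval.prob_space by simp
    qed
  qed
qed

text \<open>
  The index is shifted: \<open>irwin_hall n\<close> is the distribution function of a sum of \<open>n + 1\<close> independent
  variables uniform on \<open>[0, 1]\<close>. Starting with one variable keeps all these functions continuous.
\<close>

primrec irwin_hall :: "nat \<Rightarrow> real \<Rightarrow> real" where
  "irwin_hall 0 = uniform_cdf"
| "irwin_hall (Suc n) = (\<lambda>t. \<integral>u. irwin_hall n (t - u) \<partial>unit_interval)"

lemma log_concave_cdf_irwin_hall: "log_concave_cdf (irwin_hall n) (real n + 1)"
  by (induction n) (use log_concave_cdf_uniform log_concave_cdf_convolution in \<open>force simp: add.commute\<close>)+

text \<open>
  Passes between distances in units of \<open>pi\<close>, in which the Irwin--Hall distribution appears, and the
  true distances. The bound \<open>1 \<le> k\<close> keeps the Lipschitz constant at most one.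
\<close>

lemma log_concave_cdf_scale:
  assumes "log_concave_cdf F L" and k: "1 \<le> k"
  shows "log_concave_cdf (\<lambda>t. F (t / k)) (k * L)"
proof -
  interpret log_concave_cdf F L by fact
  show ?thesis
  proof
    show "\<bar>F (a / k) - F (b / k)\<bar> \<le> \<bar>a - b\<bar>" for a b
    proof -
      have "\<bar>F (a / k) - F (b / k)\<bar> \<le> \<bar>a - b\<bar> / k"
        using lipschitz[of "a / k" "b / k"] k by (simp add: diff_divide_distrib[symmetric])
      also have "\<dots> \<le> \<bar>a - b\<bar>" using k by (simp add: divide_le_eq mult_left_le mult_le_cancel_left1)
      finally show ?thesis .
    qed
    show "increments_log_concave (\<lambda>t. F (t / k))"
      unfolding increments_log_concave_def add_divide_distrib
      using k by (intro allI impI increments_log_concaveD[OF increments]) (auto intro: divide_right_mono)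
  qed (use k in \<open>auto intro!: mono below above divide_right_mono simp: le_divide_eq mult.commute divide_le_0_iff\<close>)
qed

section \<open>The isoperimetric inequality in a strip\<close>

text \<open>
  A function \<open>c\<close> describes the region \<open>{(t, u). t \<le> c u}\<close> in the strip \<open>0 < u < 1\<close>, whose
  \<open>(dF \<otimes> du)\<close>-measure is the integral of \<open>F (c u)\<close>. The region of a ball has \<open>c u = r - u\<close>, so the
  function \<open>X u = c u + u\<close> measures the deviation from a ball: it is constant exactly for balls. The
  hypothesis that \<open>X u - u\<close> decreases says that the region is a down-set.
\<close>

context log_concave_cdf
begin

lemma integrable_profile:
  assumes "\<And>u v. 0 < u \<Longrightarrow> u \<le> v \<Longrightarrow> v < 1 \<Longrightarrow> X v - v \<le> X u - u"
  shows "integrable unit_interval (\<lambda>u. F (X u + s - u))"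
proof (rule integrable_unit_interval_antimono_on[of _ 1])
  fix u v :: real assume "0 < u" "u \<le> v" "v < 1"
  then show "F (X v + s - v) \<le> F (X u + s - u)"
    using assms[of u v] by (intro mono) auto
qed (rule abs_le_one)

text \<open>
  When \<open>X\<close> increases, the region is flatter than the ball of parameter \<open>r\<close> and crosses its boundary
  once: the part \<open>under\<close> the ball that is missing lies at larger values of \<open>t\<close> than the part \<open>above\<close>
  it that is added. Moving everything to the right by \<open>s\<close> therefore multiplies the missing mass by
  at most the factor by which it multiplies the added mass, by log-concavity. The comparison of
  factors is done in product form, by integrating the pointwise inequality \<open>cross\<close> over both parts.
\<close>

lemma increasing_profile_expansion:
  assumes incr: "\<And>u v. 0 < u \<Longrightarrow> u \<le> v \<Longrightarrow> v < 1 \<Longrightarrow> X u \<le> X v"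
    and decr: "\<And>u v. 0 < u \<Longrightarrow> u \<le> v \<Longrightarrow> v < 1 \<Longrightarrow> X v - v \<le> X u - u"
    and s: "0 \<le> s"
    and less: "(\<integral>u. F (r - u) \<partial>unit_interval) < (\<integral>u. F (X u - u) \<partial>unit_interval)"
  shows "(\<integral>u. F (r + s - u) \<partial>unit_interval) \<le> (\<integral>u. F (X u + s - u) \<partial>unit_interval)"
proof -
  let ?I = "integral\<^sup>L unit_interval"
  define above where "above t u = F (max (X u) r + t - u) - F (r + t - u)" for t u
  define under where "under t u = F (r + t - u) - F (min (X u) r + t - u)" for t u
  have decr_max: "max (X v) r - v \<le> max (X u) r - u" and decr_min: "min (X v) r - v \<le> min (X u) r - u"
    if "0 < u" "u \<le> v" "v < 1" for u v
    using decr[OF that] that by auto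
  note int [simp] = integrable_profile[OF decr] integrable_profile[of "\<lambda>_. r"]
    integrable_profile[OF decr_max] integrable_profile[OF decr_min]
  have int_above [simp]: "integrable unit_interval (above t)"
    and int_under [simp]: "integrable unit_interval (under t)" for t
    unfolding above_def under_def by (intro Bochner_Integration.integrable_diff int; simp)+
  have nn: "0 \<le> above t u" "0 \<le> under t u" for t u
    unfolding above_def under_def by (auto intro!: mono)
  have split: "?I (\<lambda>u. F (X u + t - u)) - ?I (\<lambda>u. F (r + t - u)) = ?I (above t) - ?I (under t)" for t
  proof -
    have "F (X u + t - u) - F (r + t - u) = above t u - under t u" for u
      unfolding above_def under_def by (cases "X u \<le> r") (auto simp: max_def min_def)
    then have "?I (\<lambda>u. F (X u + t - u) - F (r + t - u)) = ?I (\<lambda>u. above t u - under t u)"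
      by simp
    then show ?thesis by simp
  qed
  have cross: "under s u * above 0 v \<le> above s v * under 0 u" if "0 < u" "u < 1" "0 < v" "v < 1" for u v
  proof (cases "X u < r \<and> r < X v")
    case True
    then have "u \<le> v" using incr[of v u] that by force
    then have "X v - v \<le> X u - u" using decr that by blast
    then show ?thesis
      using increments_log_concaveD[OF increments _ _ _ s, of "r - v" "X v - v" "X u - u" "r - u"] True
      by (simp add: above_def under_def max_def min_def algebra_simps)
  next
    case False
    then have "under t u = 0 \<and> under t' u = 0 \<or> above t v = 0 \<and> above t' v = 0" for t t'
      by (auto simp: above_def under_def max_def min_def)
    then have "under s u = 0 \<and> under 0 u = 0 \<or> above s v = 0 \<and> above 0 v = 0"
      by blast
    then show ?thesis by auto
  qed
  have "under s u * ?I (above 0) \<le> ?I (above s) * under 0 u" if "0 < u" "u < 1" for u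
  proof -
    have "?I (\<lambda>v. under s u * above 0 v) \<le> ?I (\<lambda>v. above s v * under 0 u)"
      using cross that by (intro integral_mono integrable_mult_right integrable_mult_left int_above int_under) auto
    then show ?thesis by simp
  qed
  then have "?I (\<lambda>u. under s u * ?I (above 0)) \<le> ?I (\<lambda>u. ?I (above s) * under 0 u)"
    by (intro integral_mono integrable_mult_right integrable_mult_left int_above int_under) auto
  then have *: "?I (under s) * ?I (above 0) \<le> ?I (above s) * ?I (under 0)"
    by simp
  have P: "?I (under 0) < ?I (above 0)"
    using split[of 0] less by simp
  have nnI: "0 \<le> ?I (under 0)" "0 \<le> ?I (above s)"
    by (auto intro!: Bochner_Integration.integral_nonneg nn)
  have "?I (under s) * ?I (above 0) \<le> ?I (above s) * ?I (above 0)"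
    using * P nnI by (meson less_imp_le mult_left_mono order_trans)
  then have "?I (under s) \<le> ?I (above s)"
    using P nnI by auto
  then show ?thesis using split[of s] by simp
qed

text \<open>
  The planar isoperimetric inequality. The assumption on \<open>y\<close> says that \<open>y v\<close> is at least the fibre
  mass at \<open>v\<close> of the neighbourhood of radius \<open>s\<close> in the \<open>l\<^sup>1\<close>-distance \<open>\<bar>t - t'\<bar> + \<bar>u - u'\<bar>\<close>. In terms of
  \<open>G u = c u + u\<close>, this neighbourhood has the profile \<open>H + s\<close>, where \<open>H\<close> is the supremum of \<open>G\<close> over
  the window \<open>[u - s, u]\<close>.

  The profile \<open>G\<close> is compared with an increasing one of the same measure. Below a level \<open>\<kappa>\<close>
  the valleys of \<open>G\<close> are filled, giving the running supremum \<open>M\<close> of \<open>G\<close>; above \<open>\<kappa>\<close> the peaks are shaved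
  off, giving the running infimum \<open>m\<close> of \<open>H\<close> from the right. Taking the infimum of \<open>H\<close> instead of \<open>G\<close>
  makes the comparison exact for finite \<open>s\<close> and not only in the limit of small \<open>s\<close>. The resulting
  profile \<open>K \<kappa>\<close> grows by no more than \<open>G\<close> does (\<open>expand\<close>), and \<open>\<kappa>\<close> is found by the intermediate
  value theorem. If even \<open>m\<close> exceeds the ball in measure, no level is needed, as \<open>m\<close> lies below \<open>H\<close>.
\<close>

lemma strip_isoperimetry:
  fixes c y :: "real \<Rightarrow> real"
  assumes decr: "\<And>u v. 0 < u \<Longrightarrow> u \<le> v \<Longrightarrow> v < 1 \<Longrightarrow> c v \<le> c u"
    and bound: "\<And>u. 0 < u \<Longrightarrow> u < 1 \<Longrightarrow> \<bar>c u\<bar> \<le> C"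
    and s: "0 \<le> s"
    and y_int: "integrable unit_interval y"
    and y: "\<And>u v. 0 < u \<Longrightarrow> u \<le> v \<Longrightarrow> v < 1 \<Longrightarrow> v - u \<le> s \<Longrightarrow> F (c u + s - (v - u)) \<le> y v"
    and less: "(\<integral>u. F (r - u) \<partial>unit_interval) < (\<integral>u. F (c u) \<partial>unit_interval)"
  shows "(\<integral>u. F (r + s - u) \<partial>unit_interval) \<le> integral\<^sup>L unit_interval y"
proof -
  let ?J = "{0<..<1::real}"
  let ?I = "integral\<^sup>L unit_interval"
  define G where "G u = c u + u" for u
  define H where "H u = Sup {G v |v. v \<in> ?J \<and> u - s \<le> v \<and> v \<le> u}" for u
  define M where "M u = Sup {G v |v. v \<in> ?J \<and> v \<le> u}" for u
  define m where "m u = Inf {H v |v. v \<in> ?J \<and> u \<le> v}" for u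
  have Gb: "\<bar>G u\<bar> \<le> C + 1" if "u \<in> ?J" for u
    using bound[of u] that by (auto simp: G_def)
  have bddH: "bdd_above {G v |v. v \<in> ?J \<and> u - s \<le> v \<and> v \<le> u}" for u
    using Gb by (intro bdd_aboveI[of _ "C + 1"]) fastforce
  have bddM: "bdd_above {G v |v. v \<in> ?J \<and> v \<le> u}" for u
    using Gb by (intro bdd_aboveI[of _ "C + 1"]) fastforce
  have GH: "G v \<le> H u" if "v \<in> ?J" "u - s \<le> v" "v \<le> u" for u v
    unfolding H_def using that by (intro cSup_upper bddH) auto
  have GM: "G v \<le> M u" if "v \<in> ?J" "v \<le> u" for u v
    unfolding M_def using that by (intro cSup_upper bddM) auto
  have H_le: "H u \<le> b" if "u \<in> ?J" "\<And>v. v \<in> ?J \<Longrightarrow> u - s \<le> v \<Longrightarrow> v \<le> u \<Longrightarrow> G v \<le> b" for u b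
    unfolding H_def
  proof (rule cSup_least)
    have "G u \<in> {G v |v. v \<in> ?J \<and> u - s \<le> v \<and> v \<le> u}" using that(1) s by auto
    then show "{G v |v. v \<in> ?J \<and> u - s \<le> v \<and> v \<le> u} \<noteq> {}" by blast
  qed (use that(2) in blast)
  have M_le: "M u \<le> b" if "u \<in> ?J" "\<And>v. v \<in> ?J \<Longrightarrow> v \<le> u \<Longrightarrow> G v \<le> b" for u b
    unfolding M_def
  proof (rule cSup_least)
    have "G u \<in> {G v |v. v \<in> ?J \<and> v \<le> u}" using that(1) by auto
    then show "{G v |v. v \<in> ?J \<and> v \<le> u} \<noteq> {}" by blast
  qed (use that(2) in blast)
  have Hb: "- (C + 1) \<le> H u" "H u \<le> C + 1" if "u \<in> ?J" for u
  proof -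
    show "H u \<le> C + 1" using Gb by (intro H_le[OF that]) (fastforce simp: abs_le_iff)
    show "- (C + 1) \<le> H u" using GH[of u u] Gb[OF that] s that by (auto simp: abs_le_iff)
  qed
  have bddm: "bdd_below {H v |v. v \<in> ?J \<and> u \<le> v}" for u
    using Hb by (intro bdd_belowI[of _ "- (C + 1)"]) blast
  have mH: "m u \<le> H v" if "v \<in> ?J" "u \<le> v" for u v
    unfolding m_def using that by (intro cInf_lower bddm) auto
  have m_ge: "b \<le> m u" if "u \<in> ?J" "\<And>v. v \<in> ?J \<Longrightarrow> u \<le> v \<Longrightarrow> b \<le> H v" for u b
    unfolding m_def
  proof (rule cInf_greatest)
    have "H u \<in> {H v |v. v \<in> ?J \<and> u \<le> v}" using that(1) by auto
    then show "{H v |v. v \<in> ?J \<and> u \<le> v} \<noteq> {}" by blast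
  qed (use that(2) in blast)
  have HM: "H u \<le> M u" if "u \<in> ?J" for u
    using that GM by (intro H_le) auto
  have mM: "m u \<le> M u" if "u \<in> ?J" for u
    using mH[of u u] HM that by force
  have decG: "G v - v \<le> G u - u" if "0 < u" "u \<le> v" "v < 1" for u v
    using decr[OF that] by (simp add: G_def)
  have decH: "H v - v \<le> H u - u" if "0 < u" "u \<le> v" "v < 1" for u v
  proof -
    have "H v \<le> H u + (v - u)"
    proof (rule H_le)
      fix w assume w: "w \<in> ?J" "v - s \<le> w" "w \<le> v"
      show "G w \<le> H u + (v - u)"
        using GH[of w u] GH[of u u] decG[of u w] w that s by (cases "w \<le> u") auto
    qed (use that in auto)
    then show ?thesis by simp
  qed
  have decM: "M v - v \<le> M u - u" if "0 < u" "u \<le> v" "v < 1" for u v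
  proof -
    have "M v \<le> M u + (v - u)"
    proof (rule M_le)
      fix w assume w: "w \<in> ?J" "w \<le> v"
      show "G w \<le> M u + (v - u)"
        using GM[of w u] GM[of u u] decG[of u w] w that by (cases "w \<le> u") auto
    qed (use that in auto)
    then show ?thesis by simp
  qed
  have decm: "m v - v \<le> m u - u" if "0 < u" "u \<le> v" "v < 1" for u v
  proof -
    have "m v - (v - u) \<le> m u"
    proof (rule m_ge)
      fix w assume w: "w \<in> ?J" "u \<le> w"
      show "m v - (v - u) \<le> H w"
        using mH[of w v] mH[of v v] decH[of w v] w that by (cases "v \<le> w") auto
    qed (use that in auto)
    then show ?thesis by simp
  qed
  have incM: "M u \<le> M v" if "0 < u" "u \<le> v" "v < 1" for u v
    using that by (intro M_le GM) auto
  have incm: "m u \<le> m v" if "0 < u" "u \<le> v" "v < 1" for u v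
    using that by (intro m_ge mH) auto

  have Hy: "?I (\<lambda>u. F (H u + s - u)) \<le> ?I y"
  proof (rule integral_mono[OF integrable_profile[OF decH] y_int])
    fix v assume "v \<in> space unit_interval"
    then have v: "v \<in> ?J" by simp
    show "F (H v + s - v) \<le> y v"
    proof (rule le_of_left_limit)
      fix \<epsilon> :: real assume "0 < \<epsilon>"
      then have "\<not> (\<forall>w. w \<in> ?J \<longrightarrow> v - s \<le> w \<longrightarrow> w \<le> v \<longrightarrow> G w \<le> H v - \<epsilon>)"
        using H_le[OF v, of "H v - \<epsilon>"] by force
      then obtain w where w: "w \<in> ?J" "v - s \<le> w" "w \<le> v" "H v - \<epsilon> < G w"
        by force
      have "F (H v + s - v - \<epsilon>) \<le> F (c w + s - (v - w))"
        using w by (intro mono) (auto simp: G_def)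
      also have "\<dots> \<le> y v"
        using w v by (intro y) auto
      finally show "F (H v + s - v - \<epsilon>) \<le> y v" .
    qed
  qed

  define K where "K \<kappa> u = max (m u) (min (M u) \<kappa>)" for \<kappa> u
  have incK: "K \<kappa> u \<le> K \<kappa> v" and decK: "K \<kappa> v - v \<le> K \<kappa> u - u"
    if "0 < u" "u \<le> v" "v < 1" for u v \<kappa>
    using incM[OF that] incm[OF that] decM[OF that] decm[OF that] that
    by (auto simp: K_def max_def min_def)
  let ?V = "\<lambda>X t. ?I (\<lambda>u. F (X u + t - u))"
  have decmin: "min (X v) \<kappa> - v \<le> min (X u) \<kappa> - u" and decmax: "max (X v) \<kappa> - v \<le> max (X u) \<kappa> - u"
    if "X v - v \<le> X u - u" "u \<le> v" for X :: "real \<Rightarrow> real" and u v \<kappa>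
    using that by auto

  have expand: "?V G 0 + ?V (K \<kappa>) s \<le> ?V H s + ?V (K \<kappa>) 0" for \<kappa>
  proof -
    have split: "?V X t = ?V (\<lambda>u. min (X u) \<kappa>) t + ?V (\<lambda>u. max (X u) \<kappa>) t - ?V (\<lambda>_. \<kappa>) t"
      if "\<And>u v. 0 < u \<Longrightarrow> u \<le> v \<Longrightarrow> v < 1 \<Longrightarrow> X v - v \<le> X u - u" for X t
    proof -
      have "F (X u + t - u) = F (min (X u) \<kappa> + t - u) + F (max (X u) \<kappa> + t - u) - F (\<kappa> + t - u)" for u
        by (cases "X u \<le> \<kappa>") (auto simp: max_def min_def)
      then have "?V X t = ?I (\<lambda>u. F (min (X u) \<kappa> + t - u) + F (max (X u) \<kappa> + t - u) - F (\<kappa> + t - u))"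
        by simp
      also have "\<dots> = ?V (\<lambda>u. min (X u) \<kappa>) t + ?V (\<lambda>u. max (X u) \<kappa>) t - ?V (\<lambda>_. \<kappa>) t"
      proof -
        have i: "integrable unit_interval (\<lambda>u. F (min (X u) \<kappa> + t - u))"
          "integrable unit_interval (\<lambda>u. F (max (X u) \<kappa> + t - u))"
          "integrable unit_interval (\<lambda>u. F (\<kappa> + t - u))"
          by (intro integrable_profile decmin decmax that; simp)+
        show ?thesis
          by (simp only: Bochner_Integration.integral_diff[OF Bochner_Integration.integrable_add[OF i(1,2)] i(3)]
              Bochner_Integration.integral_add[OF i(1,2)])
      qed
      finally show ?thesis .
    qed
    \<comment> \<open>Below the level, \<open>K \<kappa>\<close> agrees with \<open>M\<close>, above it with \<open>m\<close>; so \<open>split\<close> reduces the claim to the two parts.\<close>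
    have Kmin: "?V (\<lambda>u. min (K \<kappa> u) \<kappa>) t = ?V (\<lambda>u. min (M u) \<kappa>) t"
      and Kmax: "?V (\<lambda>u. max (K \<kappa> u) \<kappa>) t = ?V (\<lambda>u. max (m u) \<kappa>) t" for t
      using mM by (intro Bochner_Integration.integral_cong refl arg_cong[where f = F]; force simp: K_def max_def min_def)+
    \<comment> \<open>A point of a valley that survives in \<open>H\<close> at \<open>v\<close> was already in the same valley of \<open>G\<close> at \<open>v - s\<close>.\<close>
    have low: "?I (\<lambda>u. F (min (M u) \<kappa> + s - u) - F (min (H u) \<kappa> + s - u))
      \<le> ?I (\<lambda>u. F (min (M u) \<kappa> + 0 - u) - F (min (G u) \<kappa> + 0 - u))"
    proof (rule integral_unit_interval_shift_le[where \<delta> = "- s"])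
      fix v :: real assume v: "0 < v" "v < 1"
      show "0 \<le> F (min (M v) \<kappa> + 0 - v) - F (min (G v) \<kappa> + 0 - v)"
        using GM[of v v] v by (auto intro!: mono)
      show "F (min (M v) \<kappa> + s - v) - F (min (H v) \<kappa> + s - v) \<le> 0 \<or>
        0 < v + - s \<and> v + - s < 1 \<and> F (min (M v) \<kappa> + s - v) - F (min (H v) \<kappa> + s - v) \<le>
        F (min (M (v + - s)) \<kappa> + 0 - (v + - s)) - F (min (G (v + - s)) \<kappa> + 0 - (v + - s))"
      proof (cases "H v < M v")
        case True
        then have "\<not> (\<forall>w. w \<in> ?J \<longrightarrow> w \<le> v \<longrightarrow> G w \<le> H v)"
          using M_le[of v "H v"] v by force
        then obtain w where w: "w \<in> ?J" "w \<le> v" "H v < G w"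
          by force
        then have wv: "w < v - s" using GH[of w v] by force
        then have J: "v - s \<in> ?J" using w v s by auto
        have "M v \<le> M (v - s)"
        proof (rule M_le)
          fix x assume x: "x \<in> ?J" "x \<le> v"
          show "G x \<le> M (v - s)"
          proof (cases "x \<le> v - s")
            case False
            then have "G x \<le> H v" using GH x by auto
            also have "\<dots> \<le> M (v - s)" using w GM[of w "v - s"] wv by linarith
            finally show ?thesis .
          qed (use GM x in auto)
        qed (use v in auto)
        moreover have "G (v - s) \<le> H v" using GH J s by auto
        ultimately have "F (min (M v) \<kappa> + s - v) \<le> F (min (M (v - s)) \<kappa> - (v - s))"
          "F (min (G (v - s)) \<kappa> - (v - s)) \<le> F (min (H v) \<kappa> + s - v)"
          by (auto intro!: mono)
        then show ?thesis using J by (auto simp: add.commute)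
      next
        case False
        then have "H v = M v" using HM[of v] v by force
        then show ?thesis by simp
      qed
    qed (intro Bochner_Integration.integrable_diff integrable_profile decmin decM decH decG; simp)+
    \<comment> \<open>A peak of \<open>G\<close> at \<open>u\<close> persists in \<open>H\<close> on \<open>[u, u + s]\<close>, so whatever \<open>m\<close> shaves off at \<open>u\<close> it also shaves off at \<open>u + s\<close>.\<close>
    have up: "?I (\<lambda>u. F (max (G u) \<kappa> + 0 - u) - F (max (m u) \<kappa> + 0 - u))
      \<le> ?I (\<lambda>u. F (max (H u) \<kappa> + s - u) - F (max (m u) \<kappa> + s - u))"
    proof (rule integral_unit_interval_shift_le[where \<delta> = s])
      fix u :: real assume u: "0 < u" "u < 1"
      show "0 \<le> F (max (H u) \<kappa> + s - u) - F (max (m u) \<kappa> + s - u)"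
        using mH[of u u] u by (auto intro!: mono)
      show "F (max (G u) \<kappa> + 0 - u) - F (max (m u) \<kappa> + 0 - u) \<le> 0 \<or>
        0 < u + s \<and> u + s < 1 \<and> F (max (G u) \<kappa> + 0 - u) - F (max (m u) \<kappa> + 0 - u) \<le>
        F (max (H (u + s)) \<kappa> + s - (u + s)) - F (max (m (u + s)) \<kappa> + s - (u + s))"
      proof (cases "m u < G u")
        case True
        then have "\<not> (\<forall>w. w \<in> ?J \<longrightarrow> u \<le> w \<longrightarrow> G u \<le> H w)"
          using m_ge[of u "G u"] u by force
        then obtain w where w: "w \<in> ?J" "u \<le> w" "H w < G u"
          by force
        then have wv: "u + s < w" using GH[of u w] u by force
        then have J: "u + s \<in> ?J" using w u s by auto
        have "m (u + s) \<le> m u"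
        proof (rule m_ge)
          fix x assume x: "x \<in> ?J" "u \<le> x"
          show "m (u + s) \<le> H x"
          proof (cases "u + s \<le> x")
            case False
            have "m (u + s) \<le> H w" using mH w wv by auto
            also have "\<dots> \<le> G u" using w by simp
            also have "\<dots> \<le> H x" using False GH x u by auto
            finally show ?thesis .
          qed (use mH x in auto)
        qed (use u in auto)
        moreover have "G u \<le> H (u + s)" using GH u s by auto
        ultimately have "F (max (G u) \<kappa> - u) \<le> F (max (H (u + s)) \<kappa> + s - (u + s))"
          "F (max (m (u + s)) \<kappa> + s - (u + s)) \<le> F (max (m u) \<kappa> - u)"
          by (auto intro!: mono)
        then show ?thesis using J by (auto simp: add.commute)
      next
        case False
        then have "F (max (G u) \<kappa> + 0 - u) \<le> F (max (m u) \<kappa> + 0 - u)" by (intro mono) auto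
        then show ?thesis by simp
      qed
    qed (intro Bochner_Integration.integrable_diff integrable_profile decmax decm decH decG; simp)+
    have i: "integrable unit_interval (\<lambda>u. F (min (M u) \<kappa> + t - u))"
      "integrable unit_interval (\<lambda>u. F (min (H u) \<kappa> + t - u))"
      "integrable unit_interval (\<lambda>u. F (min (G u) \<kappa> + t - u))"
      "integrable unit_interval (\<lambda>u. F (max (m u) \<kappa> + t - u))"
      "integrable unit_interval (\<lambda>u. F (max (H u) \<kappa> + t - u))"
      "integrable unit_interval (\<lambda>u. F (max (G u) \<kappa> + t - u))" for t
      by (intro integrable_profile decmin decmax decM decm decH decG; simp)+
    have "?V (\<lambda>u. min (M u) \<kappa>) s - ?V (\<lambda>u. min (H u) \<kappa>) s \<le> ?V (\<lambda>u. min (M u) \<kappa>) 0 - ?V (\<lambda>u. min (G u) \<kappa>) 0"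
      using low by (simp only: Bochner_Integration.integral_diff[OF i(1) i(2)] Bochner_Integration.integral_diff[OF i(1) i(3)])
    moreover have "?V (\<lambda>u. max (G u) \<kappa>) 0 - ?V (\<lambda>u. max (m u) \<kappa>) 0 \<le> ?V (\<lambda>u. max (H u) \<kappa>) s - ?V (\<lambda>u. max (m u) \<kappa>) s"
      using up by (simp only: Bochner_Integration.integral_diff[OF i(6) i(4)] Bochner_Integration.integral_diff[OF i(5) i(4)])
    ultimately show ?thesis
      using split[OF decG, of 0] split[OF decH, of s] split[OF decK, of \<kappa> s] split[OF decK, of \<kappa> 0]
        Kmin[of s] Kmin[of 0] Kmax[of s] Kmax[of 0] by simp
  qed

  show ?thesis
  proof (cases "(\<integral>u. F (r - u) \<partial>unit_interval) < ?V m 0")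
    case True
    have "(\<integral>u. F (r + s - u) \<partial>unit_interval) \<le> ?V m s"
      by (rule increasing_profile_expansion[OF incm decm s]) (use True in simp_all)
    also have "\<dots> \<le> ?V H s"
      using mH by (intro integral_mono integrable_profile decm decH mono) auto
    finally show ?thesis using Hy by simp
  next
    case False
    have less': "(\<integral>u. F (r - u) \<partial>unit_interval) < ?V G 0"
      using less by (simp add: G_def)
    have GM_V: "?V G 0 \<le> ?V M 0"
      using GM by (intro integral_mono integrable_profile decG decM mono) auto
    have C0: "0 \<le> C" using bound[of "1/2"] by simp
    have Mb: "M u \<le> C + 1" and mb: "- (C + 1) \<le> m u" if "u \<in> ?J" for u
    proof -
      show "M u \<le> C + 1" using Gb by (intro M_le[OF that]) (fastforce simp: abs_le_iff)
      show "- (C + 1) \<le> m u" using Hb by (intro m_ge[OF that]) blast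
    qed
    have "?V (K (- (C + 1))) 0 = ?V m 0"
      using mb by (intro Bochner_Integration.integral_cong refl arg_cong[where f = F])
         (force simp: K_def max_def min_def)
    moreover have "?V (K (C + 1)) 0 = ?V M 0"
      using Mb mM by (intro Bochner_Integration.integral_cong refl arg_cong[where f = F])
         (force simp: K_def max_def min_def)
    moreover have "continuous_on {- (C + 1)..C + 1} (\<lambda>\<kappa>. ?V (K \<kappa>) 0)"
    proof (rule lipschitz_on_continuous_on[of 1], rule lipschitz_onI)
      fix \<kappa> \<kappa>' :: real
      have i: "integrable unit_interval (\<lambda>u. F (K \<kappa> u + 0 - u))" for \<kappa>
        by (intro integrable_profile decK)
      have "dist (?V (K \<kappa>) 0) (?V (K \<kappa>') 0) = \<bar>?I (\<lambda>u. F (K \<kappa> u + 0 - u) - F (K \<kappa>' u + 0 - u))\<bar>"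
        by (simp only: Bochner_Integration.integral_diff[OF i i] dist_real_def)
      also have "\<dots> \<le> ?I (\<lambda>u. \<bar>F (K \<kappa> u + 0 - u) - F (K \<kappa>' u + 0 - u)\<bar>)"
        by (rule integral_abs_bound)
      also have "\<dots> \<le> ?I (\<lambda>u. \<bar>\<kappa> - \<kappa>'\<bar>)"
      proof (rule integral_mono)
        fix u
        have "\<bar>K \<kappa> u - K \<kappa>' u\<bar> \<le> \<bar>\<kappa> - \<kappa>'\<bar>" by (auto simp: K_def max_def min_def)
        then show "\<bar>F (K \<kappa> u + 0 - u) - F (K \<kappa>' u + 0 - u)\<bar> \<le> \<bar>\<kappa> - \<kappa>'\<bar>"
          using lipschitz[of "K \<kappa> u + 0 - u" "K \<kappa>' u + 0 - u"] by simp
      qed (intro integrable_abs Bochner_Integration.integrable_diff i, simp)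
      also have "\<dots> = \<bar>\<kappa> - \<kappa>'\<bar>" using unit_interval.prob_space by simp
      finally show "dist (?V (K \<kappa>) 0) (?V (K \<kappa>') 0) \<le> 1 * dist \<kappa> \<kappa>'" by (simp add: dist_real_def)
    qed simp
    ultimately obtain \<kappa> where \<kappa>: "?V (K \<kappa>) 0 = ?V G 0"
      using IVT'[of "\<lambda>\<kappa>. ?V (K \<kappa>) 0" "- (C + 1)" "?V G 0" "C + 1"] GM_V False less' C0 by auto
    have "(\<integral>u. F (r + s - u) \<partial>unit_interval) \<le> ?V (K \<kappa>) s"
      by (rule increasing_profile_expansion[OF incK decK s]) (use less' \<kappa> in simp_all)
    then show ?thesis using expand[of \<kappa>] \<kappa> Hy by simp
  qed
qed

end

section \<open>Isoperimetry of products\<close>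

text \<open>
  The function \<open>a'\<close> is a quantile function, so it has the distribution of \<open>a\<close>. The measure of
  \<open>{x. y \<le> a x}\<close> is left-continuous in \<open>y\<close>, so the quantile is attained, which gives an exact equivalence.
\<close>

lemma decreasing_rearrangement:
  fixes a :: "'a \<Rightarrow> real"
  assumes "prob_space N" and a [measurable]: "a \<in> borel_measurable N"
    and a01: "\<And>x. x \<in> space N \<Longrightarrow> 0 \<le> a x \<and> a x \<le> 1"
  obtains a' :: "real \<Rightarrow> real"
  where "\<And>\<omega> y. 0 < \<omega> \<Longrightarrow> \<omega> < 1 \<Longrightarrow> \<omega> \<le> measure N {x \<in> space N. y \<le> a x} \<longleftrightarrow> y \<le> a' \<omega>"
    and "\<And>\<omega>. 0 < \<omega> \<Longrightarrow> \<omega> < 1 \<Longrightarrow> 0 \<le> a' \<omega> \<and> a' \<omega> \<le> 1"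
    and "\<And>u v. 0 < u \<Longrightarrow> u \<le> v \<Longrightarrow> v < 1 \<Longrightarrow> a' v \<le> a' u"
    and "integrable unit_interval a'"
    and "integral\<^sup>L unit_interval a' = integral\<^sup>L N a"
proof -
  interpret N: prob_space N by fact
  let ?\<mu> = "distr N borel (\<lambda>x. - a x)"
  interpret \<mu>: real_distribution ?\<mu> by (intro N.real_distribution_distr) measurable
  interpret \<mu>: cdf_distribution ?\<mu> by unfold_locales
  define a' where "a' = (\<lambda>\<omega>. - \<mu>.I \<omega>)"
  have cdf: "cdf ?\<mu> (- y) = measure N {x \<in> space N. y \<le> a x}" for y
    unfolding cdf_def by (subst measure_distr) (auto intro!: arg_cong[where f = "measure N"])
  have 1: "\<omega> \<le> measure N {x \<in> space N. y \<le> a x} \<longleftrightarrow> y \<le> a' \<omega>" if "0 < \<omega>" "\<omega> < 1" for \<omega> y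
    using \<mu>.pseudoinverse[OF that, of "- y"] by (auto simp: cdf a'_def)
  have 2: "0 \<le> a' \<omega> \<and> a' \<omega> \<le> 1" if \<omega>: "0 < \<omega>" "\<omega> < 1" for \<omega>
  proof
    have "{x \<in> space N. 0 \<le> a x} = space N" using a01 by auto
    then show "0 \<le> a' \<omega>" using 1[OF \<omega>, of 0] N.prob_space \<omega> by simp
    have "\<omega> \<le> measure N {x \<in> space N. a' \<omega> \<le> a x}" using 1[OF \<omega>] by simp
    then have "{x \<in> space N. a' \<omega> \<le> a x} \<noteq> {}" using \<omega> by force
    then show "a' \<omega> \<le> 1" using a01 by force
  qed
  have 3: "a' v \<le> a' u" if "0 < u" "u \<le> v" "v < 1" for u v
  proof -
    have "v \<le> measure N {x \<in> space N. a' v \<le> a x}" using 1[of v "a' v"] that by simp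
    then have "u \<le> measure N {x \<in> space N. a' v \<le> a x}" using that by simp
    then show ?thesis using 1[of u "a' v"] that by simp
  qed
  have "sets unit_interval = sets (restrict_space borel {0<..<1})"
    by (simp cong: sets_restrict_space_cong)
  then have meas: "\<mu>.I \<in> borel_measurable unit_interval"
    using \<mu>.measurable_CI by (simp cong: measurable_cong_sets)
  have 4: "integrable unit_interval a'"
    using 2 meas unfolding a'_def
    by (intro unit_interval.integrable_const_bound[of _ 1]) auto
  have "integral\<^sup>L unit_interval \<mu>.I = integral\<^sup>L (distr unit_interval borel \<mu>.I) (\<lambda>x. x)"
    using meas by (subst integral_distr) auto
  also have "\<dots> = (\<integral>x. x \<partial>?\<mu>)" by (simp only: \<mu>.distr_I_eq_M)
  also have "\<dots> = (\<integral>x. - a x \<partial>N)" by (subst integral_distr) auto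
  finally have 5: "integral\<^sup>L unit_interval a' = integral\<^sup>L N a"
    unfolding a'_def by simp
  show ?thesis by (rule that[OF 1 2 3 4 5])
qed

text \<open>
  The value \<open>F r\<close> is meant to be the measure of a ball of radius \<open>r\<close>. The sets \<open>B\<close> stand for measurable
  supersets of the closed \<open>s\<close>-neighbourhood of \<open>A\<close>, which itself need not be measurable. The strict
  inequality excludes the empty set \<open>A\<close> when \<open>F r = 0\<close> and is stable under approximation of \<open>r\<close> from
  below.
\<close>

definition isoperimetric :: "'a measure \<Rightarrow> ('a \<Rightarrow> 'a \<Rightarrow> real) \<Rightarrow> (real \<Rightarrow> real) \<Rightarrow> bool" where
  "isoperimetric M d F \<longleftrightarrow>
     (\<forall>A\<in>sets M. \<forall>B\<in>sets M. \<forall>r s. 0 \<le> s \<longrightarrow> (\<forall>x\<in>A. \<forall>y\<in>space M. d x y \<le> s \<longrightarrow> y \<in> B) \<longrightarrow>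
        F r < measure M A \<longrightarrow> F (r + s) \<le> measure M B)"

lemma isoperimetricI:
  assumes "\<And>A B r s. A \<in> sets M \<Longrightarrow> B \<in> sets M \<Longrightarrow> 0 \<le> s \<Longrightarrow>
      (\<And>x y. x \<in> A \<Longrightarrow> y \<in> space M \<Longrightarrow> d x y \<le> s \<Longrightarrow> y \<in> B) \<Longrightarrow>
      F r < measure M A \<Longrightarrow> F (r + s) \<le> measure M B"
  shows "isoperimetric M d F"
  using assms unfolding isoperimetric_def by blast

lemma isoperimetricD:
  assumes "isoperimetric M d F" "A \<in> sets M" "B \<in> sets M" "0 \<le> s"
    and "\<And>x y. x \<in> A \<Longrightarrow> y \<in> space M \<Longrightarrow> d x y \<le> s \<Longrightarrow> y \<in> B"
    and "F r < measure M A"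
  shows "F (r + s) \<le> measure M B"
  using assms unfolding isoperimetric_def by blast

lemma isoperimetric_distr:
  assumes iso: "isoperimetric M d F" and T: "T \<in> M \<rightarrow>\<^sub>M N"
    and d: "\<And>x y. x \<in> space M \<Longrightarrow> y \<in> space M \<Longrightarrow> d' (T x) (T y) \<le> d x y"
  shows "isoperimetric (distr M N T) d' F"
proof (rule isoperimetricI)
  fix A B r s
  assume A: "A \<in> sets (distr M N T)" and B: "B \<in> sets (distr M N T)" and s: "0 \<le> (s::real)"
    and nbh: "\<And>x y. x \<in> A \<Longrightarrow> y \<in> space (distr M N T) \<Longrightarrow> d' x y \<le> s \<Longrightarrow> y \<in> B"
    and less: "F r < measure (distr M N T) A"
  have "F (r + s) \<le> measure M (T -` B \<inter> space M)"
  proof (rule isoperimetricD[OF iso])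
    show "F r < measure M (T -` A \<inter> space M)"
      using less A T by (simp add: measure_distr)
    show "y \<in> T -` B \<inter> space M" if "x \<in> T -` A \<inter> space M" "y \<in> space M" "d x y \<le> s" for x y
      using that d[of x y] nbh[of "T x" "T y"] measurable_space[OF T] by auto
  qed (use A B T s in \<open>auto intro: measurable_sets\<close>)
  then show "F (r + s) \<le> measure (distr M N T) B"
    using B T by (simp add: measure_distr)
qed

context log_concave_cdf
begin

definition quantile :: "real \<Rightarrow> real" where
  "quantile y = Sup {t. F t < y}"

lemma quantile_below:
  assumes "0 < y" "t < quantile y"
  shows "F t < y"
proof -
  have "0 \<in> {t. F t < y}" using assms(1) by (simp add: below)
  then obtain t' where "F t' < y" "t < t'"
    using less_cSupD[of "{t. F t < y}" t] assms(2) unfolding quantile_def by blast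
  then show ?thesis using mono[of t t'] by simp
qed

lemma le_upper_end: "F t < y \<Longrightarrow> y \<le> 1 \<Longrightarrow> t \<le> L"
  using above[of t] by (cases "L \<le> t") auto

lemma quantile_bdd: "y \<le> 1 \<Longrightarrow> bdd_above {t. F t < y}"
  by (intro bdd_aboveI[of _ L]) (auto intro: le_upper_end)

lemma quantile_bounds:
  assumes "0 < y" "y \<le> 1"
  shows "0 \<le> quantile y" "quantile y \<le> L"
proof -
  have 0: "0 \<in> {t. F t < y}" using assms(1) by (simp add: below)
  show "0 \<le> quantile y" unfolding quantile_def by (rule cSup_upper[OF 0 quantile_bdd[OF assms(2)]])
  show "quantile y \<le> L" unfolding quantile_def
    using 0 assms(2) by (intro cSup_least) (auto intro: le_upper_end)
qed

lemma cdf_quantile: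
  assumes "0 < y" "y \<le> 1"
  shows "F (quantile y) = y"
proof (rule antisym)
  show "F (quantile y) \<le> y"
    by (rule le_of_left_limit) (use quantile_below[OF assms(1)] in \<open>simp add: less_imp_le\<close>)
  have "y \<le> F (quantile y + \<epsilon>)" if "0 < \<epsilon>" for \<epsilon>
  proof (rule ccontr)
    assume "\<not> ?thesis"
    then have "quantile y + \<epsilon> \<le> quantile y"
      unfolding quantile_def by (intro cSup_upper quantile_bdd assms) auto
    then show False using that by simp
  qed
  then have "y \<le> F (quantile y) + \<epsilon>" if "0 < \<epsilon>" for \<epsilon>
    using lipschitz[of "quantile y + \<epsilon>" "quantile y"] that by force
  then show "y \<le> F (quantile y)" by (rule field_le_epsilon)
qed

lemma quantile_mono: "0 < y \<Longrightarrow> y \<le> z \<Longrightarrow> z \<le> 1 \<Longrightarrow> quantile y \<le> quantile z"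
  unfolding quantile_def
  by (rule cSup_subset_mono) (use below quantile_bdd in \<open>auto intro!: exI[of _ 0]\<close>)

text \<open>
  Every fibre \<open>A\<^sub>y\<close> is replaced by the ball of the same measure, its radius being given by \<open>quantile\<close>. The
  isoperimetry of \<open>M\<close> controls how the fibre over \<open>y\<close> spreads to fibres over points near \<open>y\<close>. The
  isoperimetry of \<open>N\<close> controls how the superlevel sets of the fibre measures spread, so the fibre
  measures may be rearranged into a decreasing function on the unit interval. What is left is
  the planar problem in the strip.
\<close>

lemma isoperimetric_pair:
  fixes M :: "'a measure" and N :: "'b measure"
  assumes M: "prob_space M" and N: "prob_space N"
    and isoM: "isoperimetric M d F" and isoN: "isoperimetric N e uniform_cdf"
    and e: "\<And>x y. x \<in> space N \<Longrightarrow> y \<in> space N \<Longrightarrow> 0 \<le> e x y"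
  shows "isoperimetric (M \<Otimes>\<^sub>M N) (\<lambda>p q. d (fst p) (fst q) + e (snd p) (snd q))
           (\<lambda>t. \<integral>u. F (t - u) \<partial>unit_interval)"
proof (rule isoperimetricI)
  interpret M: prob_space M by fact
  interpret N: prob_space N by fact
  interpret MN: pair_prob_space M N ..
  fix A B r s
  assume A [measurable]: "A \<in> sets (M \<Otimes>\<^sub>M N)" and B [measurable]: "B \<in> sets (M \<Otimes>\<^sub>M N)" and s: "0 \<le> (s::real)"
    and nbh: "\<And>p q. p \<in> A \<Longrightarrow> q \<in> space (M \<Otimes>\<^sub>M N) \<Longrightarrow> d (fst p) (fst q) + e (snd p) (snd q) \<le> s \<Longrightarrow> q \<in> B"
    and less: "(\<integral>u. F (r - u) \<partial>unit_interval) < measure (M \<Otimes>\<^sub>M N) A"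
  define sec where "sec C y = measure M ((\<lambda>x. (x, y)) -` C)" for C :: "('a \<times> 'b) set" and y
  have sec_sets: "(\<lambda>x. (x, y)) -` C \<in> sets M" if "C \<in> sets (M \<Otimes>\<^sub>M N)" for C y
    using that by (rule sets_Pair2)
  have sec_meas [measurable]: "sec C \<in> borel_measurable N" if "C \<in> sets (M \<Otimes>\<^sub>M N)" for C
    using MN.measurable_emeasure_Pair2[OF that] unfolding sec_def measure_def by measurable
  have sec01: "0 \<le> sec C y \<and> sec C y \<le> 1" for C y
    by (simp add: sec_def)
  have sec_int: "measure (M \<Otimes>\<^sub>M N) C = integral\<^sup>L N (sec C)" if C: "C \<in> sets (M \<Otimes>\<^sub>M N)" for C
  proof -
    have "ennreal (measure (M \<Otimes>\<^sub>M N) C) = emeasure (M \<Otimes>\<^sub>M N) C"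
      by (simp add: MN.emeasure_eq_measure)
    also have "\<dots> = (\<integral>\<^sup>+y. ennreal (sec C y) \<partial>N)"
      unfolding sec_def by (subst MN.emeasure_pair_measure_alt2[OF C]) (simp add: M.emeasure_eq_measure)
    also have "\<dots> = ennreal (integral\<^sup>L N (sec C))"
      using sec01 sec_meas[OF C]
      by (intro nn_integral_eq_integral N.integrable_const_bound[of _ 1]) auto
    finally show ?thesis
      using sec01 by (simp add: Bochner_Integration.integral_nonneg)
  qed
  obtain a where a: "\<And>\<omega> y. 0 < \<omega> \<Longrightarrow> \<omega> < 1 \<Longrightarrow> \<omega> \<le> measure N {x \<in> space N. y \<le> sec A x} \<longleftrightarrow> y \<le> a \<omega>"
    and a01: "\<And>\<omega>. 0 < \<omega> \<Longrightarrow> \<omega> < 1 \<Longrightarrow> 0 \<le> a \<omega> \<and> a \<omega> \<le> 1"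
    and a_mono: "\<And>u v. 0 < u \<Longrightarrow> u \<le> v \<Longrightarrow> v < 1 \<Longrightarrow> a v \<le> a u"
    and a_int: "integrable unit_interval a" "integral\<^sup>L unit_interval a = integral\<^sup>L N (sec A)"
    by (rule decreasing_rearrangement[OF N sec_meas[OF A] sec01]) (rule that; blast)
  obtain b where b: "\<And>\<omega> y. 0 < \<omega> \<Longrightarrow> \<omega> < 1 \<Longrightarrow> \<omega> \<le> measure N {x \<in> space N. y \<le> sec B x} \<longleftrightarrow> y \<le> b \<omega>"
    and b01: "\<And>\<omega>. 0 < \<omega> \<Longrightarrow> \<omega> < 1 \<Longrightarrow> 0 \<le> b \<omega> \<and> b \<omega> \<le> 1"
    and b_int: "integrable unit_interval b" "integral\<^sup>L unit_interval b = integral\<^sup>L N (sec B)"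
    by (rule decreasing_rearrangement[OF N sec_meas[OF B] sec01]) (rule that; blast)
  \<comment> \<open>A null fibre gets the radius \<open>- s\<close>, so that the bound that it imposes on fibres within distance \<open>s\<close> is 0.\<close>
  define c where "c u = (if 0 < a u then quantile (a u) else - s)" for u
  have Fc: "F (c u) = a u" if "0 < u" "u < 1" for u
    using a01[OF that] cdf_quantile[of "a u"] s by (auto simp: c_def below)
  have "(\<integral>u. F (r + s - u) \<partial>unit_interval) \<le> integral\<^sup>L unit_interval b"
  proof (rule strip_isoperimetry)
    show "c v \<le> c u" if "0 < u" "u \<le> v" "v < 1" for u v
      using a_mono[OF that] a01[of u] a01[of v] that s quantile_mono[of "a v" "a u"] quantile_bounds[of "a u"]
      by (auto simp: c_def)
    show "\<bar>c u\<bar> \<le> L + s" if "0 < u" "u < 1" for u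
      using a01[OF that] s quantile_bounds[of "a u"] quantile_bounds[of 1] by (auto simp: c_def)
    have "(\<integral>u. F (c u) \<partial>unit_interval) = integral\<^sup>L unit_interval a"
      by (rule Bochner_Integration.integral_cong) (auto simp: Fc)
    then show "(\<integral>u. F (r - u) \<partial>unit_interval) < (\<integral>u. F (c u) \<partial>unit_interval)"
      using less by (simp add: sec_int[OF A] a_int)
    show "F (c u + s - (v - u)) \<le> b v" if uv: "0 < u" "u \<le> v" "v < 1" "v - u \<le> s" for u v
    proof (cases "0 < a u")
      case False
      then have "F (c u + s - (v - u)) = 0" using uv by (intro below) (auto simp: c_def)
      then show ?thesis using b01[of v] uv by simp
    next
      case True
      let ?z = "F (c u + s - (v - u))"
      let ?A = "{x \<in> space N. a u \<le> sec A x}" and ?B = "{x \<in> space N. ?z \<le> sec B x}"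
      have uA: "u \<le> measure N ?A" using a[of u "a u"] uv by simp
      have near: "y \<in> ?B" if x: "x \<in> ?A" and y: "y \<in> space N" and xy: "e x y \<le> v - u" for x y
      proof -
        have "?z \<le> sec B y"
        proof (rule le_of_left_limit)
          fix \<epsilon> :: real assume "0 < \<epsilon>"
          then have "F (c u - \<epsilon>) < a u" using quantile_below[OF True] True by (simp add: c_def)
          then have l: "F (c u - \<epsilon>) < measure M ((\<lambda>z. (z, x)) -` A)" using x by (simp add: sec_def)
          have "F (c u - \<epsilon> + (s - e x y)) \<le> measure M ((\<lambda>z. (z, y)) -` B)"
          proof (rule isoperimetricD[OF isoM sec_sets[OF A] sec_sets[OF B] _ _ l])
            fix p q assume "p \<in> (\<lambda>z. (z, x)) -` A" "q \<in> space M" "d p q \<le> s - e x y"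
            then show "q \<in> (\<lambda>z. (z, y)) -` B"
              using nbh[of "(p, x)" "(q, y)"] y by (simp add: space_pair_measure)
          qed (use xy uv in simp)
          then show "F (c u + s - (v - u) - \<epsilon>) \<le> sec B y"
            using mono[of "c u + s - (v - u) - \<epsilon>" "c u - \<epsilon> + (s - e x y)"] xy by (simp add: sec_def)
        qed
        then show ?thesis using y by simp
      qed
      have "v \<le> measure N ?B"
      proof (rule dense_le_bounded[of 0])
        show "0 < v" using uv by simp
        fix w assume w: "0 < w" "w < v"
        have "uniform_cdf (w - (v - u)) < measure N ?A"
          using uA w uv by (auto simp: uniform_cdf_def)
        then have "uniform_cdf (w - (v - u) + (v - u)) \<le> measure N ?B"
          using uv near by (intro isoperimetricD[OF isoN, of ?A]) auto
        then show "w \<le> measure N ?B" using w uv by (simp add: uniform_cdf_def)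
      qed
      then show ?thesis using b[of v ?z] uv by simp
    qed
  qed (use s b_int in auto)
  then show "(\<integral>u. F (r + s - u) \<partial>unit_interval) \<le> measure (M \<Otimes>\<^sub>M N) B"
    by (simp add: sec_int[OF B] b_int)
qed

end

section \<open>The circle\<close>

lemma circle_cis:
  assumes "z \<in> circle"
  obtains t where "0 \<le> t" "t < 2 * pi" "z = cis t"
proof (rule that)
  show "0 \<le> Arg2pi z" "Arg2pi z < 2 * pi" using Arg2pi by auto
  show "z = cis (Arg2pi z)"
    using Arg2pi_eq[of z] assms by (simp add: cis_conv_exp)
qed

lemma circle_dist_cis_le: "circle_dist (cis a) (cis b) \<le> \<bar>b - a\<bar>"
  by (rule circle_dist_le) (simp add: cis_mult)

lemma circle_dist_cis:
  assumes "\<bar>b - a\<bar> \<le> pi"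
  shows "circle_dist (cis a) (cis b) = \<bar>b - a\<bar>"
proof -
  have "circle_dist (cis a) (cis b) = \<bar>Arg (cis b / cis a)\<bar>"
    by (rule circle_dist_eq_Arg) auto
  also have "cis b / cis a = cis (b - a)"
    by (rule cis_divide)
  also have "\<bar>Arg (cis (b - a))\<bar> = \<bar>b - a\<bar>"
  proof (cases "b - a = - pi")
    case True
    moreover have "cis (- pi) = cis pi" by (simp add: complex_eq_iff)
    ultimately show ?thesis using Arg_cis[of pi] by simp
  next
    case False
    then show ?thesis using assms by (subst Arg_cis) auto
  qed
  finally show ?thesis .
qed

lemma cis_period: "cis (t + 2 * pi) = cis t"
  by (simp add: cis_mult[symmetric])

lemma borel_vimage_cis:
  assumes "A \<in> sets circle_measure"
  shows "cis -` A \<in> sets borel"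
proof -
  have "cis \<in> borel_measurable borel"
    by (intro borel_measurable_continuous_onI continuous_intros)
  then have "cis \<in> borel \<rightarrow>\<^sub>M restrict_space borel circle"
    by (intro measurable_restrict_space2) auto
  then show ?thesis
    using assms measurable_sets[of cis borel _ A] by (simp add: sets_circle_measure)
qed

text \<open>
  The circle may be cut at any point \<open>cis \<tau>\<close>: rotation invariance of arc length, read off from the
  periodicity of \<open>cis\<close>.
\<close>

lemma measure_circle:
  assumes A: "A \<in> sets circle_measure" and \<tau>: "0 \<le> \<tau>" "\<tau> < 2 * pi"
  shows "measure circle_measure A = measure lborel {t \<in> {\<tau>..<\<tau> + 2 * pi}. cis t \<in> A} / (2 * pi)"
proof -
  define P where "P = {t. cis t \<in> A}"
  have P [measurable]: "P \<in> sets borel"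
    using borel_vimage_cis[OF A] by (simp add: P_def vimage_def)
  have fin: "P \<inter> {a..<b} \<in> fmeasurable lborel" for a b
  proof (rule fmeasurableI)
    have "bounded (P \<inter> {a..<b})" by (rule bounded_subset[of "{a..b}"]) auto
    then show "emeasure lborel (P \<inter> {a..<b}) < \<infinity>"
      using emeasure_bounded_finite by simp
    show "P \<inter> {a..<b} \<in> sets lborel" using P by simp
  qed
  have shift: "measure lborel (P \<inter> {2 * pi..<\<tau> + 2 * pi}) = measure lborel (P \<inter> {0..<\<tau>})"
  proof -
    have "measure lborel (P \<inter> {2 * pi..<\<tau> + 2 * pi}) = measure (distr lborel borel ((+) (2 * pi))) (P \<inter> {2 * pi..<\<tau> + 2 * pi})"
      by (simp add: lborel_distr_plus)
    also have "\<dots> = measure lborel ((+) (2 * pi) -` (P \<inter> {2 * pi..<\<tau> + 2 * pi}))"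
      by (subst measure_distr) auto
    also have "(+) (2 * pi) -` (P \<inter> {2 * pi..<\<tau> + 2 * pi}) = P \<inter> {0..<\<tau>}"
      using cis_period by (auto simp: P_def add.commute)
    finally show ?thesis .
  qed
  have U: "measure lborel (P \<inter> {a..<c}) = measure lborel (P \<inter> {a..<b}) + measure lborel (P \<inter> {b..<c})"
    if "a \<le> b" "b \<le> c" for a b c
  proof -
    have "P \<inter> {a..<c} = (P \<inter> {a..<b}) \<union> (P \<inter> {b..<c})" "(P \<inter> {a..<b}) \<inter> (P \<inter> {b..<c}) = {}"
      using that by auto
    then show ?thesis
      using measure_Un3[OF fin fin, of a b b c] by simp
  qed
  have "measure circle_measure A = measure (uniform_measure lborel {0..<2 * pi}) P"
    using A cis_measurable unfolding circle_measure_def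
    by (subst measure_distr) (auto simp: P_def vimage_def)
  also have "\<dots> = measure lborel (P \<inter> {0..<2 * pi}) / (2 * pi)"
    using pi_gt_zero P by (subst measure_uniform_measure) (auto simp: Int_commute ennreal_mult' ennreal_mult_eq_top_iff)
  also have "measure lborel (P \<inter> {0..<2 * pi}) = measure lborel (P \<inter> {\<tau>..<\<tau> + 2 * pi})"
    using U[of 0 \<tau> "2 * pi"] U[of \<tau> "2 * pi" "\<tau> + 2 * pi"] shift \<tau> by simp
  also have "P \<inter> {\<tau>..<\<tau> + 2 * pi} = {t \<in> {\<tau>..<\<tau> + 2 * pi}. cis t \<in> A}"
    by (auto simp: P_def)
  finally show ?thesis .
qed

text \<open>
  Unless the neighbourhood \<open>B\<close> is the whole circle, the circle can be cut at a point outside \<open>B\<close>. The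
  set \<open>A\<close> then becomes a subset of an interval that keeps the distance \<open>pi * s\<close> from both ends, and \<open>B\<close>
  contains, besides \<open>A\<close>, an interval of length \<open>pi * s\<close> before the infimum and one after the
  supremum of \<open>A\<close>.
\<close>

lemma isoperimetric_circle:
  "isoperimetric circle_measure (\<lambda>x y. circle_dist x y / pi) uniform_cdf"
proof (rule isoperimetricI)
  interpret prob_space circle_measure by (rule prob_space_circle_measure)
  interpret U: log_concave_cdf uniform_cdf 1 by (rule log_concave_cdf_uniform)
  fix A B r s
  assume A: "A \<in> sets circle_measure" and B: "B \<in> sets circle_measure" and s: "0 \<le> (s::real)"
    and nbh: "\<And>x y. x \<in> A \<Longrightarrow> y \<in> space circle_measure \<Longrightarrow> circle_dist x y / pi \<le> s \<Longrightarrow> y \<in> B"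
    and less: "uniform_cdf r < measure circle_measure A"
  have near: "cis y \<in> B" if "cis x \<in> A" "\<bar>y - x\<bar> \<le> pi * s" for x y
    using that circle_dist_cis_le[of x y] by (intro nbh) (auto simp: divide_le_eq mult.commute)
  show "uniform_cdf (r + s) \<le> measure circle_measure B"
  proof (cases "B = circle")
    case True
    then show ?thesis using prob_space U.le_one by simp
  next
    case False
    then obtain q where "q \<in> circle" "q \<notin> B"
      using sets.sets_into_space[OF B] unfolding space_circle_measure by blast
    then obtain \<tau> where \<tau>: "0 \<le> \<tau>" "\<tau> < 2 * pi" "cis \<tau> \<notin> B"
      by (metis circle_cis)
    define a b where "a = Inf {t \<in> {\<tau>..<\<tau> + 2 * pi}. cis t \<in> A}"
      and "b = Sup {t \<in> {\<tau>..<\<tau> + 2 * pi}. cis t \<in> A}"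
    let ?A = "{t \<in> {\<tau>..<\<tau> + 2 * pi}. cis t \<in> A}" and ?B = "{t \<in> {\<tau>..<\<tau> + 2 * pi}. cis t \<in> B}"
    have meas: "{t \<in> {\<tau>..<\<tau> + 2 * pi}. cis t \<in> X} \<in> fmeasurable lborel"
      if X: "X \<in> sets circle_measure" for X
    proof -
      have "cis -` X \<in> sets borel"
        using X by (rule borel_vimage_cis)
      then have "cis -` X \<inter> {\<tau>..<\<tau> + 2 * pi} \<in> fmeasurable lborel"
        using fmeasurable_Int_fmeasurable[of "{\<tau>..<\<tau> + 2 * pi}" lborel "cis -` X"]
        by (simp add: Int_commute fmeasurable_def)
      also have "cis -` X \<inter> {\<tau>..<\<tau> + 2 * pi} = {t \<in> {\<tau>..<\<tau> + 2 * pi}. cis t \<in> X}" by auto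
      finally show ?thesis .
    qed
    have mA: "measure circle_measure A = measure lborel ?A / (2 * pi)"
      and mB: "measure circle_measure B = measure lborel ?B / (2 * pi)"
      by (rule measure_circle; fact)+
    have ne: "?A \<noteq> {}"
    proof
      assume "?A = {}"
      then have "measure circle_measure A = 0" using mA by (metis div_0 measure_empty)
      then show False using less U.nonneg[of r] by simp
    qed
    have bnd: "\<tau> + pi * s \<le> t \<and> t \<le> \<tau> + 2 * pi - pi * s" if t: "t \<in> ?A" for t
    proof (rule ccontr)
      assume "\<not> ?thesis"
      then have "\<bar>\<tau> - t\<bar> \<le> pi * s \<or> \<bar>(\<tau> + 2 * pi) - t\<bar> \<le> pi * s"
        using t by auto
      then have "cis \<tau> \<in> B \<or> cis (\<tau> + 2 * pi) \<in> B"
        using near t by blast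
      then show False using \<tau> cis_period by simp
    qed
    have bdd: "bdd_below ?A" "bdd_above ?A"
      by (auto intro!: bdd_belowI[of _ \<tau>] bdd_aboveI[of _ "\<tau> + 2 * pi"])
    have ab: "a \<le> t" "t \<le> b" if "t \<in> ?A" for t
      unfolding a_def b_def using that bdd by (auto intro: cInf_lower cSup_upper)
    have a_ge: "\<tau> + pi * s \<le> a"
      unfolding a_def using ne bnd by (intro cInf_greatest) blast+
    have b_le: "b \<le> \<tau> + 2 * pi - pi * s"
      unfolding b_def using ne bnd by (intro cSup_least) blast+
    have a_le_b: "a \<le> b" using ne ab by force
    have "{a - pi * s<..<a} \<subseteq> ?B"
    proof
      fix x assume x: "x \<in> {a - pi * s<..<a}"
      then obtain t where t: "t \<in> ?A" "t < x + pi * s"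
        using cInf_lessD[OF ne, of "x + pi * s"] by (auto simp: a_def)
      then have "cis x \<in> B" using ab(1)[OF t(1)] x by (intro near[of t]) auto
      then show "x \<in> ?B" using x a_ge a_le_b b_le s by auto
    qed
    moreover have "{b<..<b + pi * s} \<subseteq> ?B"
    proof
      fix x assume x: "x \<in> {b<..<b + pi * s}"
      then obtain t where t: "t \<in> ?A" "x - pi * s < t"
        using less_cSupD[OF ne, of "x - pi * s"] by (auto simp: b_def)
      then have "cis x \<in> B" using ab(2)[OF t(1)] x by (intro near[of t]) auto
      then show "x \<in> ?B" using x a_ge a_le_b b_le s mult_nonneg_nonneg[of pi s] by auto
    qed
    moreover have "?A \<subseteq> ?B" using near s by auto
    ultimately have sub: "?A \<union> ({a - pi * s<..<a} \<union> {b<..<b + pi * s}) \<subseteq> ?B" by blast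
    have io: "{u<..<v::real} \<in> fmeasurable lborel" for u v
      by (cases "u \<le> v") (auto simp: fmeasurable_def)
    have "measure lborel ?A + 2 * (pi * s) = measure lborel (?A \<union> ({a - pi * s<..<a} \<union> {b<..<b + pi * s}))"
    proof -
      have "{a - pi * s<..<a} \<inter> {b<..<b + pi * s} = {}" using a_le_b by auto
      then have "measure lborel ({a - pi * s<..<a} \<union> {b<..<b + pi * s}) = 2 * (pi * s)"
        using measure_Un3[OF io io, of "a - pi * s" a b "b + pi * s"] s by simp
      moreover have "?A \<inter> ({a - pi * s<..<a} \<union> {b<..<b + pi * s}) = {}" using ab by force
      ultimately show ?thesis
        using measure_Un3[OF meas[OF A] fmeasurable.Un[OF io io], of "a - pi * s" a b "b + pi * s"] by simp
    qed
    also have "\<dots> \<le> measure lborel ?B"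
      by (intro measure_mono_fmeasurable[OF sub] fmeasurableD fmeasurable.Un meas A B io)
    finally have "(measure lborel ?A + 2 * (pi * s)) / (2 * pi) \<le> measure lborel ?B / (2 * pi)"
      by (rule divide_right_mono) simp
    then have "measure circle_measure A + s \<le> measure circle_measure B"
      by (simp only: mA mB add_divide_distrib) simp
    then show ?thesis
      using less U.lipschitz[of "r + s" r] s by simp
  qed
qed

section \<open>The torus\<close>

lemma torus_dist_fun_upd:
  "torus_dist (Suc n) (x(n := a)) (y(n := b)) = torus_dist n x y + circle_dist a b"
  by (auto simp: torus_dist_def intro!: sum.cong)

lemma torus_measure_one:
  "(\<lambda>x. \<lambda>i\<in>{..<Suc 0}. x) \<in> circle_measure \<rightarrow>\<^sub>M torus_measure (Suc 0)"
  "torus_measure (Suc 0) = distr circle_measure (torus_measure (Suc 0)) (\<lambda>x. \<lambda>i\<in>{..<Suc 0}. x)"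
proof -
  interpret prob_space circle_measure by (rule prob_space_circle_measure)
  interpret product_sigma_finite "\<lambda>_ :: nat. circle_measure" by unfold_locales
  have "{..<Suc 0} = {0}" by auto
  then show "torus_measure (Suc 0) = distr circle_measure (torus_measure (Suc 0)) (\<lambda>x. \<lambda>i\<in>{..<Suc 0}. x)"
    using distr_component[of 0] by (simp add: torus_measure_def)
  show "(\<lambda>x. \<lambda>i\<in>{..<Suc 0}. x) \<in> circle_measure \<rightarrow>\<^sub>M torus_measure (Suc 0)"
    unfolding torus_measure_def by (intro measurable_restrict) auto
qed

lemma torus_measure_Suc:
  "(\<lambda>p. (fst p)(n := snd p)) \<in> torus_measure n \<Otimes>\<^sub>M circle_measure \<rightarrow>\<^sub>M torus_measure (Suc n)"
  "torus_measure (Suc n) = distr (torus_measure n \<Otimes>\<^sub>M circle_measure) (torus_measure (Suc n))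
     (\<lambda>p. (fst p)(n := snd p))"
proof -
  interpret C: prob_space circle_measure by (rule prob_space_circle_measure)
  interpret T: prob_space "torus_measure n" by (rule prob_space_torus_measure)
  interpret P: pair_prob_space "torus_measure n" circle_measure ..
  let ?T = "\<lambda>p. (fst p)(n := snd p)" and ?swap = "\<lambda>(x :: complex, y :: nat \<Rightarrow> complex). (y, x)"
  have m: "?T \<in> torus_measure n \<Otimes>\<^sub>M circle_measure \<rightarrow>\<^sub>M torus_measure (Suc n)"
    unfolding torus_measure_def lessThan_Suc by (rule measurable_fun_upd[where J = "{..<n}"]) auto
  then show "?T \<in> torus_measure n \<Otimes>\<^sub>M circle_measure \<rightarrow>\<^sub>M torus_measure (Suc n)" .
  have "torus_measure (Suc n) = distr (circle_measure \<Otimes>\<^sub>M torus_measure n) (torus_measure (Suc n)) (?T \<circ> ?swap)"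
    using distr_pair_PiM_eq_PiM[of "{..<n}" "\<lambda>_. circle_measure" n] prob_space_circle_measure
    by (simp add: torus_measure_def lessThan_Suc comp_def case_prod_beta')
  also have "\<dots> = distr (distr (circle_measure \<Otimes>\<^sub>M torus_measure n) (torus_measure n \<Otimes>\<^sub>M circle_measure) ?swap)
      (torus_measure (Suc n)) ?T"
    by (rule distr_distr[symmetric, OF m]) (rule measurable_pair_swap')
  also have "distr (circle_measure \<Otimes>\<^sub>M torus_measure n) (torus_measure n \<Otimes>\<^sub>M circle_measure) ?swap
      = torus_measure n \<Otimes>\<^sub>M circle_measure"
    by (rule P.distr_pair_swap[symmetric])
  finally show "torus_measure (Suc n) = distr (torus_measure n \<Otimes>\<^sub>M circle_measure) (torus_measure (Suc n)) ?T" .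
qed

text \<open>
  Lengths are measured in units of \<open>pi\<close>, the diameter of the circle.
\<close>

lemma isoperimetric_torus:
  "isoperimetric (torus_measure (Suc n)) (\<lambda>x y. torus_dist (Suc n) x y / pi) (irwin_hall n)"
proof (induction n)
  case 0
  show ?case
    unfolding irwin_hall.simps
    by (subst torus_measure_one(2), rule isoperimetric_distr[OF isoperimetric_circle torus_measure_one(1)])
       (simp add: torus_dist_def)
next
  case (Suc n)
  interpret log_concave_cdf "irwin_hall n" "real n + 1" by (rule log_concave_cdf_irwin_hall)
  have "isoperimetric (torus_measure (Suc n) \<Otimes>\<^sub>M circle_measure)
      (\<lambda>p q. torus_dist (Suc n) (fst p) (fst q) / pi + circle_dist (snd p) (snd q) / pi) (irwin_hall (Suc n))"
    unfolding irwin_hall.simps(2)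
    by (rule isoperimetric_pair[OF prob_space_torus_measure prob_space_circle_measure Suc isoperimetric_circle])
       (simp add: circle_dist_nonneg)
  then show ?case
    by (subst torus_measure_Suc(2), rule isoperimetric_distr[OF _ torus_measure_Suc(1)])
       (simp add: torus_dist_fun_upd add_divide_distrib)
qed

lemma torus_dist_measurable_Lipschitz:
  assumes "p \<in> torus n"
  shows "torus_dist n p \<in> borel_measurable (torus_measure n)"
    and "one_Lipschitz_on (torus n) (torus_dist n) (torus_dist n p)"
proof -
  show "one_Lipschitz_on (torus n) (torus_dist n) (torus_dist n p)"
    unfolding one_Lipschitz_on_def
  proof (intro ballI)
    fix x y assume xy: "x \<in> torus n" "y \<in> torus n"
    show "\<bar>torus_dist n p x - torus_dist n p y\<bar> \<le> torus_dist n x y"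
      using torus_dist_triangle[OF assms xy] torus_dist_triangle[OF assms xy(2,1)] torus_dist_commute[OF xy]
      by linarith
  qed
  then show "torus_dist n p \<in> borel_measurable (torus_measure n)"
    by (rule one_Lipschitz_on_torus_measurable)
qed

text \<open>
  The circle is the one-dimensional torus, where Lipschitz functions are known to be measurable.
\<close>

lemma measurable_circle_dist:
  assumes "q \<in> circle"
  shows "circle_dist q \<in> borel_measurable circle_measure"
proof -
  have "(\<lambda>i\<in>{..<Suc 0}. q) \<in> torus (Suc 0)" using assms by (auto simp: torus_def)
  then show ?thesis
    using measurable_compose[OF torus_measure_one(1) torus_dist_measurable_Lipschitz(1), of "\<lambda>i\<in>{..<Suc 0}. q"]
    by (simp add: torus_dist_def)
qed

text \<open>
  The circle is cut at the antipode of \<open>q\<close>, so that the distance from \<open>q\<close> becomes the distance from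
  the midpoint of an interval of length \<open>2 * pi\<close>.
\<close>

lemma measure_circle_ball:
  assumes q: "q \<in> circle"
  shows "measure circle_measure {y \<in> circle. circle_dist q y / pi \<le> x} = uniform_cdf x"
proof -
  have "- q \<in> circle" using q by simp
  then obtain \<tau> where \<tau>: "0 \<le> \<tau>" "\<tau> < 2 * pi" "- q = cis \<tau>" by (rule circle_cis)
  have q': "q = cis (\<tau> + pi)" using \<tau>(3) by (simp add: cis_mult[symmetric]) (metis minus_minus)
  have d: "circle_dist q (cis t) = \<bar>t - (\<tau> + pi)\<bar>" if "t \<in> {\<tau>..<\<tau> + 2 * pi}" for t
    unfolding q' using that by (intro circle_dist_cis) auto
  have [measurable]: "circle_dist q \<in> borel_measurable circle_measure" by (rule measurable_circle_dist[OF q])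
  have "{y \<in> space circle_measure. circle_dist q y / pi \<le> x} \<in> sets circle_measure" by measurable
  then have "measure circle_measure {y \<in> circle. circle_dist q y / pi \<le> x}
      = measure lborel {t \<in> {\<tau>..<\<tau> + 2 * pi}. cis t \<in> {y \<in> circle. circle_dist q y / pi \<le> x}} / (2 * pi)"
    using \<tau> by (intro measure_circle) auto
  also have "{t \<in> {\<tau>..<\<tau> + 2 * pi}. cis t \<in> {y \<in> circle. circle_dist q y / pi \<le> x}}
      = {t \<in> {\<tau>..<\<tau> + 2 * pi}. \<bar>t - (\<tau> + pi)\<bar> \<le> pi * x}"
    using d by (auto simp: divide_le_eq mult.commute)
  also have "measure lborel {t \<in> {\<tau>..<\<tau> + 2 * pi}. \<bar>t - (\<tau> + pi)\<bar> \<le> pi * x} / (2 * pi) = uniform_cdf x"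
  proof -
    define h where "h = pi * x"
    let ?S = "{t \<in> {\<tau>..<\<tau> + 2 * pi}. \<bar>t - (\<tau> + pi)\<bar> \<le> h}"
    consider "x < 0" | "0 \<le> x" "x < 1" | "1 \<le> x" by linarith
    then have "measure lborel ?S / (2 * pi) = uniform_cdf x"
    proof cases
      case 1
      then have "h < 0" by (simp add: h_def mult_less_0_iff)
      then have E: "?S = {}" by auto
      show ?thesis unfolding E using 1 by (simp add: uniform_cdf_def)
    next
      case 2
      then have "0 \<le> h" "h < pi" by (simp_all add: h_def)
      then have E: "?S = {\<tau> + pi - h..\<tau> + pi + h}" by (auto simp: abs_le_iff)
      show ?thesis unfolding E using 2 \<open>0 \<le> h\<close> by (simp add: uniform_cdf_def h_def)
    next
      case 3
      then have "pi \<le> h" by (simp add: h_def)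
      then have E: "?S = {\<tau>..<\<tau> + 2 * pi}" by (auto simp: abs_le_iff)
      show ?thesis unfolding E using 3 by (simp add: uniform_cdf_def)
    qed
    then show ?thesis by (simp add: h_def)
  qed
  finally show ?thesis .
qed

lemma distr_circle_dist:
  assumes q: "q \<in> circle"
  shows "distr circle_measure borel (\<lambda>y. circle_dist q y / pi) = distr unit_interval borel (\<lambda>u. u)"
proof (rule cdf_unique)
  interpret prob_space circle_measure by (rule prob_space_circle_measure)
  have [measurable]: "circle_dist q \<in> borel_measurable circle_measure" by (rule measurable_circle_dist[OF q])
  have id: "(\<lambda>u::real. u) \<in> borel_measurable unit_interval"
    by (intro measurable_restrict_space1) simp
  show "real_distribution (distr circle_measure borel (\<lambda>y. circle_dist q y / pi))"
    by (intro real_distribution_distr) measurable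
  show "real_distribution (distr unit_interval borel (\<lambda>u. u))"
    using id by (rule unit_interval.real_distribution_distr)
  show "cdf (distr circle_measure borel (\<lambda>y. circle_dist q y / pi)) = cdf (distr unit_interval borel (\<lambda>u. u))"
  proof
    fix x
    have "cdf (distr circle_measure borel (\<lambda>y. circle_dist q y / pi)) x
        = measure circle_measure {y \<in> circle. circle_dist q y / pi \<le> x}"
      unfolding cdf_def by (subst measure_distr) (auto intro!: arg_cong[where f = "measure circle_measure"])
    also have "\<dots> = uniform_cdf x" by (rule measure_circle_ball[OF q])
    also have "\<dots> = measure lborel ({..x} \<inter> {0<..<1})"
    proof -
      consider "x \<le> 0" | "0 < x" "x < 1" | "1 \<le> x" by linarith
      then show ?thesis
      proof cases
        case 1
        then have "{..x} \<inter> {0<..<1} = {}" by auto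
        then show ?thesis using 1 by (simp add: uniform_cdf_def)
      next
        case 2
        then have "{..x} \<inter> {0<..<1} = {0<..x}" by auto
        then show ?thesis using 2 by (simp add: uniform_cdf_def)
      next
        case 3
        then have "{..x} \<inter> {0<..<1} = {0<..<1}" by auto
        then show ?thesis using 3 by (simp add: uniform_cdf_def)
      qed
    qed
    also have "\<dots> = cdf (distr unit_interval borel (\<lambda>u. u)) x"
      unfolding cdf_def
      by (subst measure_distr[OF id]) (auto simp: measure_restrict_space)
    finally show "cdf (distr circle_measure borel (\<lambda>y. circle_dist q y / pi)) x
        = cdf (distr unit_interval borel (\<lambda>u. u)) x" .
  qed
qed

text \<open>
  The distances from \<open>p\<close> in the single coordinates are independent and, in units of \<open>pi\<close>, uniform on
  \<open>[0, 1]\<close>. So their sum has the Irwin--Hall distribution.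
\<close>

lemma measure_torus_ball:
  assumes "p \<in> torus (Suc n)"
  shows "measure (torus_measure (Suc n)) {x \<in> torus (Suc n). torus_dist (Suc n) p x \<le> pi * t} = irwin_hall n t"
  using assms
proof (induction n arbitrary: p t)
  case 0
  have q: "p 0 \<in> circle" using torusD[OF 0] by simp
  have [measurable]: "torus_dist (Suc 0) p \<in> borel_measurable (torus_measure (Suc 0))"
    by (rule torus_dist_measurable_Lipschitz(1)[OF 0])
  have "{x \<in> space (torus_measure (Suc 0)). torus_dist (Suc 0) p x \<le> pi * t} \<in> sets (torus_measure (Suc 0))"
    by measurable
  then have "measure (torus_measure (Suc 0)) {x \<in> torus (Suc 0). torus_dist (Suc 0) p x \<le> pi * t}
      = measure circle_measure {y \<in> circle. circle_dist (p 0) y / pi \<le> t}"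
    by (subst torus_measure_one(2), subst measure_distr[OF torus_measure_one(1)])
       (auto simp: torus_dist_def torus_def divide_le_eq mult.commute
         intro!: arg_cong[where f = "measure circle_measure"])
  then show ?case using measure_circle_ball[OF q] by simp
next
  case (Suc n)
  interpret C: prob_space circle_measure by (rule prob_space_circle_measure)
  interpret T: prob_space "torus_measure (Suc n)" by (rule prob_space_torus_measure)
  interpret P: pair_prob_space "torus_measure (Suc n)" circle_measure ..
  interpret log_concave_cdf "irwin_hall n" "real n + 1" by (rule log_concave_cdf_irwin_hall)
  let ?N = "Suc n"
  \<comment> \<open>Points of a torus are undefined outside its index set, so \<open>p\<close> has to be restricted.\<close>
  define p' where "p' = restrict p {..<?N}"
  have p': "p' \<in> torus ?N" using Suc.prems by (auto simp: torus_def p'_def PiE_iff)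
  have q: "p ?N \<in> circle" using torusD[OF Suc.prems] by simp
  have [measurable]: "circle_dist (p ?N) \<in> borel_measurable circle_measure"
    by (rule measurable_circle_dist[OF q])
  have [measurable]: "torus_dist ?N p' \<in> borel_measurable (torus_measure ?N)"
    by (rule torus_dist_measurable_Lipschitz(1)[OF p'])
  have [measurable]: "torus_dist (Suc ?N) p \<in> borel_measurable (torus_measure (Suc ?N))"
    by (rule torus_dist_measurable_Lipschitz(1)[OF Suc.prems])
  let ?X = "{z \<in> space (torus_measure ?N \<Otimes>\<^sub>M circle_measure). torus_dist ?N p' (fst z) + circle_dist (p ?N) (snd z) \<le> pi * t}"
  have X: "?X \<in> sets (torus_measure ?N \<Otimes>\<^sub>M circle_measure)" by measurable
  have dist: "torus_dist (Suc ?N) p (x(?N := y)) = torus_dist ?N p' x + circle_dist (p ?N) y" for x y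
    by (simp add: torus_dist_def p'_def)
  have "{x \<in> space (torus_measure (Suc ?N)). torus_dist (Suc ?N) p x \<le> pi * t} \<in> sets (torus_measure (Suc ?N))"
    by measurable
  then have "measure (torus_measure (Suc ?N)) {x \<in> torus (Suc ?N). torus_dist (Suc ?N) p x \<le> pi * t}
      = measure (torus_measure ?N \<Otimes>\<^sub>M circle_measure) ?X"
    using measurable_space[OF torus_measure_Suc(1)[of ?N]]
    by (subst torus_measure_Suc(2), subst measure_distr[OF torus_measure_Suc(1)])
       (auto simp: dist intro!: arg_cong[where f = "measure (torus_measure ?N \<Otimes>\<^sub>M circle_measure)"])
  also have "\<dots> = (\<integral>y. irwin_hall n (t - circle_dist (p ?N) y / pi) \<partial>circle_measure)"
  proof -
    have "ennreal (measure (torus_measure ?N \<Otimes>\<^sub>M circle_measure) ?X)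
        = (\<integral>\<^sup>+y. emeasure (torus_measure ?N) ((\<lambda>x. (x, y)) -` ?X) \<partial>circle_measure)"
      using P.emeasure_pair_measure_alt2[OF X] by (simp add: P.emeasure_eq_measure)
    also have "\<dots> = (\<integral>\<^sup>+y. ennreal (irwin_hall n (t - circle_dist (p ?N) y / pi)) \<partial>circle_measure)"
    proof (rule nn_integral_cong)
      fix y assume y: "y \<in> space circle_measure"
      have "(\<lambda>x. (x, y)) -` ?X = {x \<in> torus ?N. torus_dist ?N p' x \<le> pi * (t - circle_dist (p ?N) y / pi)}"
        using y by (auto simp: space_pair_measure algebra_simps)
      then show "emeasure (torus_measure ?N) ((\<lambda>x. (x, y)) -` ?X) = ennreal (irwin_hall n (t - circle_dist (p ?N) y / pi))"
        using Suc.IH[OF p'] by (simp add: T.emeasure_eq_measure)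
    qed
    also have "\<dots> = ennreal (\<integral>y. irwin_hall n (t - circle_dist (p ?N) y / pi) \<partial>circle_measure)"
      using nonneg abs_le_one
      by (intro nn_integral_eq_integral C.integrable_const_bound[of _ 1]) auto
    finally show ?thesis
      using nonneg by (simp add: Bochner_Integration.integral_nonneg)
  qed
  also have "\<dots> = (\<integral>u. irwin_hall n (t - u) \<partial>distr circle_measure borel (\<lambda>y. circle_dist (p ?N) y / pi))"
    by (subst integral_distr) auto
  also have "\<dots> = (\<integral>u. irwin_hall n (t - u) \<partial>unit_interval)"
    unfolding distr_circle_dist[OF q]
    by (subst integral_distr) (auto intro!: measurable_restrict_space1)
  finally show ?case by simp
qed

section \<open>From isoperimetry to domination\<close>

text \<open>
  The complement of the support is a union of null sets from a countable basis.
\<close>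

lemma msupport_AE:
  fixes \<nu> :: "'a :: second_countable_topology measure"
  assumes "sets \<nu> = sets borel"
  shows "msupport \<nu> \<in> sets borel" "AE x in \<nu>. x \<in> msupport \<nu>"
proof -
  obtain \<B> :: "'a set set" where \<B>: "countable \<B>" "topological_basis \<B>"
    using ex_countable_basis by blast
  let ?N = "{U \<in> \<B>. emeasure \<nu> U = 0}"
  have op: "open U" if "U \<in> \<B>" for U
    using topological_basis_open[OF \<B>(2) that] .
  have "- msupport \<nu> = \<Union> ?N"
  proof (intro subset_antisym subsetI)
    fix x assume "x \<in> - msupport \<nu>"
    then obtain U where U: "open U" "x \<in> U" "emeasure \<nu> U = 0"
      by (auto simp: msupport_def)
    then obtain V where V: "V \<in> \<B>" "x \<in> V" "V \<subseteq> U"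
      using topological_basisE[OF \<B>(2)] by metis
    have "emeasure \<nu> V = 0"
      using emeasure_mono[OF V(3), of \<nu>] U assms by simp
    then show "x \<in> \<Union> ?N" using V by blast
  next
    fix x assume "x \<in> \<Union> ?N"
    then show "x \<in> - msupport \<nu>" using op by (force simp: msupport_def)
  qed
  moreover have "\<Union> ?N \<in> null_sets \<nu>"
    using \<B>(1) op assms by (intro null_sets_UN'[of ?N "\<lambda>U. U", simplified]) (auto simp: null_sets_def)
  ultimately have N: "- msupport \<nu> \<in> null_sets \<nu>" by simp
  then have "- msupport \<nu> \<in> sets borel" using assms by (auto simp: null_sets_def)
  then show "msupport \<nu> \<in> sets borel"
    using sets.compl_sets[of "- msupport \<nu>" borel] by (simp add: Compl_eq_Diff_UNIV[symmetric] double_diff)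
  show "AE x in \<nu>. x \<in> msupport \<nu>" using AE_not_in[OF N] by simp
qed

lemma distr_restrict_msupport:
  fixes \<nu> :: "'a :: second_countable_topology measure"
  assumes \<nu>: "sets \<nu> = sets borel" and f: "f \<in> \<nu> \<rightarrow>\<^sub>M N"
  shows "distr (restrict_space \<nu> (msupport \<nu>)) N f = distr \<nu> N f"
proof (rule measure_eqI)
  have sp: "space \<nu> = UNIV" using sets_eq_imp_space_eq[OF \<nu>] by simp
  fix X assume "X \<in> sets (distr (restrict_space \<nu> (msupport \<nu>)) N f)"
  then have X: "X \<in> sets N" by simp
  have S: "msupport \<nu> \<in> sets \<nu>" using msupport_AE(1)[OF \<nu>] \<nu> by simp
  have fX: "f -` X \<in> sets \<nu>" using measurable_sets[OF f X] sp by simp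
  have "emeasure (distr (restrict_space \<nu> (msupport \<nu>)) N f) X = emeasure \<nu> (f -` X \<inter> msupport \<nu>)"
    using X S f sp
    by (subst emeasure_distr)
       (auto intro: measurable_restrict_space1 simp: space_restrict_space emeasure_restrict_space)
  also have "\<dots> = emeasure \<nu> (f -` X)"
    using msupport_AE(2)[OF \<nu>] fX S by (intro emeasure_eq_AE) auto
  also have "\<dots> = emeasure (distr \<nu> N f) X"
    using X f sp by (subst emeasure_distr) auto
  finally show "emeasure (distr (restrict_space \<nu> (msupport \<nu>)) N f) X = emeasure (distr \<nu> N f) X" .
qed simp

context log_concave_cdf
begin

text \<open>
  If \<open>F\<close> were constant on \<open>[s, t]\<close>, there would be mass to the left of \<open>s\<close> and none on \<open>[s, t]\<close>.
  Log-concavity then forbids mass on every translate of \<open>[s, t]\<close> to the right, so \<open>F\<close> would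
  never reach 1.
\<close>

lemma strict_mono:
  assumes "F s < 1" "0 < F t" "s < t"
  shows "F s < F t"
proof (rule ccontr)
  assume "\<not> ?thesis"
  then have eq: "F s = F t" using mono[of s t] assms by simp
  have flat: "F (t + h) \<le> F (s + h)" if "0 \<le> h" for h
  proof -
    have "(F (t + h) - F (s + h)) * F s \<le> 0"
      using increments_log_concaveD[OF increments, of "min s 0" s s t h] that assms(3) eq by (simp add: below)
    then show ?thesis using assms(2) eq by (simp add: mult_le_0_iff)
  qed
  have "F (s + real k * (t - s)) \<le> F s" for k
  proof (induction k)
    case (Suc k)
    have "F (s + real (Suc k) * (t - s)) = F (t + real k * (t - s))" by (simp add: algebra_simps)
    also have "\<dots> \<le> F (s + real k * (t - s))" using assms(3) by (intro flat) simp
    finally show ?case using Suc by simp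
  qed simp
  moreover obtain k where "L - s < real k * (t - s)"
    using reals_Archimedean3[of "t - s"] assms(3) by force
  ultimately show False
    using above[of "s + real k * (t - s)"] assms(1) by (smt (verit))
qed

text \<open>
  The weak inequality follows by letting \<open>r\<close> increase to its limit, since \<open>F\<close> is strictly increasing
  where its values lie between 0 and 1.
\<close>

lemma isoperimetric_le:
  assumes M: "prob_space M" and iso: "isoperimetric M d F"
    and d: "\<And>x. x \<in> space M \<Longrightarrow> d x x = 0"
    and A: "A \<in> sets M" and B: "B \<in> sets M" and s: "0 \<le> s"
    and nbh: "\<And>x y. x \<in> A \<Longrightarrow> y \<in> space M \<Longrightarrow> d x y \<le> s \<Longrightarrow> y \<in> B"
    and pos: "0 < measure M A" and le: "F r \<le> measure M A"
  shows "F (r + s) \<le> measure M B"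
proof -
  interpret M: prob_space M by fact
  note I = isoperimetricD[OF iso A B s nbh]
  consider "F r = 0" | "0 < F r" "F r < 1" | "F r = 1"
    using nonneg[of r] le_one[of r] by linarith
  then show ?thesis
  proof cases
    case 1
    then show ?thesis using pos by (intro I) auto
  next
    case 2
    show ?thesis
    proof (rule le_of_left_limit)
      fix \<epsilon> :: real assume \<epsilon>: "0 < \<epsilon>"
      have "F (r - \<epsilon>) < F r"
        using 2 \<epsilon> mono[of "r - \<epsilon>" r] by (intro strict_mono) auto
      then have "F (r - \<epsilon> + s) \<le> measure M B"
        using le by (intro I) auto
      then show "F (r + s - \<epsilon>) \<le> measure M B"
        by (simp add: algebra_simps)
    qed
  next
    case 3
    have "A \<subseteq> B" using nbh d s sets.sets_into_space[OF A] by force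
    then have "measure M A \<le> measure M B" using B by (rule M.finite_measure_mono)
    then show ?thesis using 3 le le_one[of "r + s"] by simp
  qed
qed

text \<open>
  The map \<open>f\<close> sends \<open>r\<close> to the least level \<open>a\<close> at which the sublevel set of \<open>\<phi>\<close> has at least the measure
  \<open>F r\<close> of a ball of radius \<open>r\<close>. It transports \<open>\<nu>\<close> to the distribution of \<open>\<phi>\<close>, as
  every quantile transform does. The isoperimetric inequality makes it 1-Lipschitz: the sublevel set at
  \<open>a + s\<close> contains the \<open>s\<close>-neighbourhood of the one at \<open>a\<close>.
\<close>

theorem dominates_pushforward:
  assumes M: "prob_space M" and iso: "isoperimetric M d F"
    and d: "\<And>x. x \<in> space M \<Longrightarrow> d x x = 0"
    and \<phi>_meas [measurable]: "\<phi> \<in> borel_measurable M"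
    and \<phi>: "one_Lipschitz_on (space M) d \<phi>"
    and \<nu>: "real_distribution \<nu>" and cdf_\<nu>: "cdf \<nu> = F"
  shows "\<nu> \<succ>' distr M borel \<phi>"
proof -
  interpret M: prob_space M by fact
  interpret \<nu>: real_distribution \<nu> by fact
  let ?\<mu> = "distr M borel \<phi>"
  interpret \<mu>: real_distribution ?\<mu> by (intro M.real_distribution_distr) measurable
  define C where "C = cdf ?\<mu>"
  have C: "C a = measure M {x \<in> space M. \<phi> x \<le> a}" for a
    unfolding C_def cdf_def by (subst measure_distr) (auto intro!: arg_cong[where f = "measure M"])
  have C_mono: "C a \<le> C b" if "a \<le> b" for a b
    unfolding C_def by (rule \<mu>.cdf_nondecreasing[OF that])
  have C_le1: "C a \<le> 1" and C_nn: "0 \<le> C a" for a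
    unfolding C_def using \<mu>.cdf_bounded_prob \<mu>.cdf_nonneg by auto
  have C_step: "F (r + s) \<le> C (a + s)" if "0 < C a" "F r \<le> C a" "0 \<le> s" for a r s
    unfolding C
  proof (rule isoperimetric_le[OF M iso d, of "{x \<in> space M. \<phi> x \<le> a}"])
    show "y \<in> {x \<in> space M. \<phi> x \<le> a + s}"
      if "x \<in> {x \<in> space M. \<phi> x \<le> a}" "y \<in> space M" "d x y \<le> s" for x y
      using that \<phi> unfolding one_Lipschitz_on_def by fastforce
  qed (use that in \<open>auto simp: C\<close>)
  \<comment> \<open>The condition \<open>0 < C a\<close> makes \<open>f r\<close> the essential infimum of \<open>\<phi>\<close> when \<open>F r = 0\<close>; without it, \<open>S r\<close> would be unbounded below.\<close>
  define S where "S r = {a. 0 < C a \<and> F r \<le> C a}" for r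
  define f where "f r = Inf (S r)" for r
  obtain a\<^sub>1 where a\<^sub>1: "0 < C a\<^sub>1"
    using order_tendstoD(1)[OF \<mu>.cdf_lim_at_top_prob, of 0] eventually_happens'[OF trivial_limit_at_top_linorder]
    unfolding C_def by force
  have S_ne: "S r \<noteq> {}" for r
  proof -
    have "F (0 + max L 0) \<le> C (a\<^sub>1 + max L 0)" using a\<^sub>1 by (intro C_step) (auto simp: below)
    then have "C (a\<^sub>1 + max L 0) = 1" using above[of "max L 0"] C_le1 by (simp add: antisym)
    then show ?thesis using le_one[of r] by (auto simp: S_def intro!: exI[of _ "a\<^sub>1 + max L 0"])
  qed
  \<comment> \<open>If every sublevel set had positive measure, the inequality would give full measure to each of them.\<close>
  obtain a\<^sub>0 where a\<^sub>0: "C a\<^sub>0 = 0"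
  proof -
    obtain b where b: "C b < 1"
      using order_tendstoD(2)[OF \<mu>.cdf_lim_at_bot, of 1] eventually_happens'[OF trivial_limit_at_bot_linorder]
      unfolding C_def by force
    have "C (b - max L 0) = 0"
    proof (rule ccontr)
      assume "\<not> ?thesis"
      then have "F (0 + max L 0) \<le> C (b - max L 0 + max L 0)"
        using C_nn[of "b - max L 0"] by (intro C_step) (auto simp: below less_le)
      then show False using above[of "max L 0"] b by simp
    qed
    then show ?thesis by (rule that)
  qed
  have S_bdd: "bdd_below (S r)" for r
  proof (rule bdd_belowI[of _ a\<^sub>0])
    fix a assume "a \<in> S r"
    then show "a\<^sub>0 \<le> a" using C_mono[of a a\<^sub>0] a\<^sub>0 by (cases "a \<le> a\<^sub>0") (auto simp: S_def)
  qed
  have S_up: "b \<in> S r" if "a \<in> S r" "a \<le> b" for a b r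
    using that C_mono[of a b] by (auto simp: S_def)
  have f_le: "f r \<le> a" if "a \<in> S r" for a r
    unfolding f_def using that S_bdd by (rule cInf_lower)
  have f_less: "a \<in> S r" if "f r < a" for a r
  proof -
    obtain b where "b \<in> S r" "b < a"
      using cInf_lessD[OF S_ne, of r a] \<open>f r < a\<close> unfolding f_def by blast
    then show ?thesis using S_up by simp
  qed
  have f_mono: "f r \<le> f t" if "r \<le> t" for r t
    unfolding f_def using mono[OF that]
    by (intro cInf_superset_mono S_ne S_bdd) (auto simp: S_def)
  have f_step: "f (r + s) \<le> f r + s" if s: "0 \<le> s" for r s
  proof -
    have "f (r + s) - s \<le> a" if "a \<in> S r" for a
    proof -
      have "a + s \<in> S (r + s)"
        using that s C_step[of a r s] C_mono[of a "a + s"] by (auto simp: S_def)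
      then show ?thesis using f_le by fastforce
    qed
    then have "f (r + s) - s \<le> f r"
      unfolding f_def[of r] using S_ne by (intro cInf_greatest)
    then show ?thesis by simp
  qed
  have f_supp: "f r \<in> msupport ?\<mu>" for r
    unfolding msupport_def
  proof (intro CollectI allI impI)
    fix U assume U: "open U \<and> f r \<in> U"
    then obtain \<epsilon> where \<epsilon>: "0 < \<epsilon>" "ball (f r) \<epsilon> \<subseteq> U" by (meson openE)
    have "emeasure ?\<mu> U \<noteq> 0"
    proof
      assume "emeasure ?\<mu> U = 0"
      then have "measure ?\<mu> U = 0" by (simp add: measure_def)
      moreover have "{f r - \<epsilon>/2<..f r + \<epsilon>/2} \<subseteq> U" using \<epsilon> by (force simp: dist_real_def)
      ultimately have "measure ?\<mu> {f r - \<epsilon>/2<..f r + \<epsilon>/2} = 0"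
        using \<mu>.finite_measure_mono[of "{f r - \<epsilon>/2<..f r + \<epsilon>/2}" U] U
        by (simp add: antisym)
      then have "C (f r + \<epsilon>/2) = C (f r - \<epsilon>/2)"
        using \<mu>.cdf_diff_eq[of "f r - \<epsilon>/2" "f r + \<epsilon>/2"] \<epsilon> by (simp add: C_def)
      moreover have "f r + \<epsilon>/2 \<in> S r" using \<epsilon> by (intro f_less) simp
      ultimately have "f r - \<epsilon>/2 \<in> S r" by (simp add: S_def)
      then show False using f_le[of "f r - \<epsilon>/2" r] \<epsilon> by simp
    qed
    then show "0 < emeasure ?\<mu> U" by (simp add: zero_less_iff_neq_zero)
  qed
  have f_meas [measurable]: "f \<in> borel_measurable borel"
    by (intro borel_measurable_mono monoI f_mono)
  then have f_meas_\<nu> [measurable]: "f \<in> borel_measurable \<nu>"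
    by (simp cong: measurable_cong_sets)
  have "distr \<nu> borel f = ?\<mu>"
  proof (rule cdf_unique)
    show "real_distribution (distr \<nu> borel f)" by (intro \<nu>.real_distribution_distr) measurable
    show "real_distribution ?\<mu>" by unfold_locales
    show "cdf (distr \<nu> borel f) = cdf ?\<mu>"
    proof
      fix a
      have *: "cdf (distr \<nu> borel f) a = measure \<nu> {r. f r \<le> a}"
        unfolding cdf_def by (subst measure_distr) (auto intro!: arg_cong[where f = "measure \<nu>"])
      have sub: "F r \<le> C a" if "f r \<le> a" for r
      proof -
        have "((\<lambda>b. C b) \<longlongrightarrow> C a) (at_right a)"
          using \<mu>.cdf_is_right_cont[of a] by (simp add: C_def continuous_within)
        moreover have "\<forall>\<^sub>F b in at_right a. F r \<le> C b"
          using f_less[of r] that by (auto simp: S_def eventually_at_right_field intro!: exI[of _ "a + 1"])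
        ultimately show ?thesis by (rule tendsto_lowerbound) simp
      qed
      have "measure \<nu> {r. f r \<le> a} \<le> C a"
      proof (cases "C a = 1")
        case True
        then show ?thesis by simp
      next
        case False
        then have lt: "C a < 1" using C_le1[of a] by simp
        let ?R = "{r. F r \<le> C a}"
        have ne: "?R \<noteq> {}" using C_nn[of a] below[of 0] by (auto intro!: exI[of _ 0])
        have bdd: "bdd_above ?R"
        proof (rule bdd_aboveI[of _ L])
          fix r assume "r \<in> ?R"
          then show "r \<le> L" using lt above[of r] by (cases "L \<le> r") auto
        qed
        have "F (Sup ?R) \<le> C a"
        proof (rule le_of_left_limit)
          fix \<epsilon> :: real assume "0 < \<epsilon>"
          then obtain r where "r \<in> ?R" "Sup ?R - \<epsilon> < r"
            using less_cSupD[OF ne, of "Sup ?R - \<epsilon>"] by auto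
          then show "F (Sup ?R - \<epsilon>) \<le> C a" using mono[of "Sup ?R - \<epsilon>" r] by simp
        qed
        moreover have "{r. f r \<le> a} \<subseteq> {..Sup ?R}"
          using sub bdd by (auto intro!: cSup_upper)
        then have "measure \<nu> {r. f r \<le> a} \<le> measure \<nu> {..Sup ?R}"
          by (intro \<nu>.finite_measure_mono) auto
        ultimately show ?thesis by (simp add: cdf_\<nu>[symmetric] cdf_def)
      qed
      moreover have "C a \<le> measure \<nu> {r. f r \<le> a}"
      proof (cases "0 < C a")
        case True
        have "C a = measure \<nu> {..quantile (C a)}"
          using cdf_quantile[OF True C_le1] by (simp add: cdf_\<nu>[symmetric] cdf_def)
        also have "\<dots> \<le> measure \<nu> {r. f r \<le> a}"
        proof (rule \<nu>.finite_measure_mono)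
          show "{..quantile (C a)} \<subseteq> {r. f r \<le> a}"
          proof
            fix r assume "r \<in> {..quantile (C a)}"
            then have "F r \<le> C a" using cdf_quantile[OF True C_le1] mono[of r "quantile (C a)"] by simp
            then show "r \<in> {r. f r \<le> a}" using True by (auto intro!: f_le simp: S_def)
          qed
          show "{r. f r \<le> a} \<in> sets \<nu>" by simp
        qed
        finally show ?thesis .
      next
        case False
        then show ?thesis using C_nn[of a] measure_nonneg[of \<nu> "{r. f r \<le> a}"] by linarith
      qed
      ultimately show "cdf (distr \<nu> borel f) a = cdf ?\<mu> a" by (simp add: * C_def)
    qed
  qed
  moreover have "distr (restrict_space \<nu> (msupport \<nu>)) borel f = distr \<nu> borel f"
    by (rule distr_restrict_msupport) simp_all
  moreover have "1-lipschitz_on (msupport \<nu>) f"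
  proof (rule lipschitz_onI)
    fix x y
    show "dist (f x) (f y) \<le> 1 * dist x y"
      using f_step[of "y - x" x] f_step[of "x - y" y] f_mono[of x y] f_mono[of y x]
      by (cases "x \<le> y") (auto simp: dist_real_def)
  qed simp
  ultimately show ?thesis
    unfolding iso_Lipschitz_ge_def using f_supp f_mono
    by (intro exI[of _ f]) (auto intro: mono_onI)
qed

end

section \<open>The distance function dominates all 1-Lipschitz functions\<close>

theorem theorem1p12:
  fixes n :: nat and p :: "nat \<Rightarrow> complex" and \<xi> :: "(nat \<Rightarrow> complex) \<Rightarrow> real"
  assumes "n \<ge> 1" and "p \<in> torus n"
    and "\<xi> = torus_dist n p"
  shows "distr (torus_measure n) borel \<xi> \<in> measurement1 (torus n) (torus_dist n) (torus_measure n) \<and>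
    (\<forall>\<mu> \<in> measurement1 (torus n) (torus_dist n) (torus_measure n).
       distr (torus_measure n) borel \<xi> \<succ>' \<mu>)"
proof
  obtain m where m: "n = Suc m" using assms(1) by (cases n) auto
  note \<xi> = torus_dist_measurable_Lipschitz[OF assms(2), folded assms(3)]
  show "distr (torus_measure n) borel \<xi> \<in> measurement1 (torus n) (torus_dist n) (torus_measure n)"
    using \<xi>(2) by (auto simp: measurement1_def)
  interpret T: prob_space "torus_measure n" by (rule prob_space_torus_measure)
  define F where "F t = irwin_hall m (t / pi)" for t
  interpret log_concave_cdf F "pi * (real m + 1)"
    unfolding F_def using pi_ge_two by (intro log_concave_cdf_scale log_concave_cdf_irwin_hall) simp
  have iso: "isoperimetric (torus_measure n) (torus_dist n) F"
  proof (rule isoperimetricI)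
    fix A B r s
    assume *: "A \<in> sets (torus_measure n)" "B \<in> sets (torus_measure n)" "0 \<le> (s::real)"
      "\<And>x y. x \<in> A \<Longrightarrow> y \<in> space (torus_measure n) \<Longrightarrow> torus_dist n x y \<le> s \<Longrightarrow> y \<in> B"
      "F r < measure (torus_measure n) A"
    have "irwin_hall m (r / pi + s / pi) \<le> measure (torus_measure n) B"
      using * by (intro isoperimetricD[OF isoperimetric_torus[of m, folded m], of A])
        (auto simp: F_def divide_le_cancel)
    then show "F (r + s) \<le> measure (torus_measure n) B" by (simp add: F_def add_divide_distrib)
  qed
  have cdf: "cdf (distr (torus_measure n) borel \<xi>) = F"
  proof
    fix t
    have "cdf (distr (torus_measure n) borel \<xi>) t = measure (torus_measure n) {x \<in> torus n. torus_dist n p x \<le> pi * (t / pi)}"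
      unfolding cdf_def using \<xi>(1) assms(3)
      by (subst measure_distr) (auto intro!: arg_cong[where f = "measure (torus_measure n)"])
    also have "\<dots> = F t"
      using measure_torus_ball[of p m "t / pi"] assms(2) by (simp add: F_def m)
    finally show "cdf (distr (torus_measure n) borel \<xi>) t = F t" .
  qed
  show "\<forall>\<mu> \<in> measurement1 (torus n) (torus_dist n) (torus_measure n). distr (torus_measure n) borel \<xi> \<succ>' \<mu>"
  proof
    fix \<mu> assume "\<mu> \<in> measurement1 (torus n) (torus_dist n) (torus_measure n)"
    then obtain \<phi> where \<phi>: "one_Lipschitz_on (torus n) (torus_dist n) \<phi>" "\<mu> = distr (torus_measure n) borel \<phi>"
      by (auto simp: measurement1_def)
    show "distr (torus_measure n) borel \<xi> \<succ>' \<mu>"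
      unfolding \<phi>(2)
    proof (rule dominates_pushforward[OF prob_space_torus_measure iso])
      show "torus_dist n x x = 0" if "x \<in> space (torus_measure n)" for x
        using that torus_dist_zero_iff[of x n x] by simp
      show "real_distribution (distr (torus_measure n) borel \<xi>)"
        using \<xi>(1) by (rule T.real_distribution_distr)
    qed (use \<phi> cdf one_Lipschitz_on_torus_measurable in auto)
  qed
qed

end
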